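(* Let $G_0=SO^*(\infty)$. The bounded symmetric domain $D_0=G_0(\mathcal F)$, $\mathcal F=(0,V_-,V)$, is realized as the bounded domain consisting of all finitary linear maps $Z:V_-\to V_+$ such that the matrix of $Z$ is antisymmetric and $I-Z^*Z$ is positive definite; here $(0,F^{(1)},V)\in D_0$ corresponds to the map $Z$ given by $\pi_-(x)\mapsto\pi_+(x)$ for $x\in F^{(1)}$. In that realization the action of $G_0$ is $$\begin{pmatrix}A&B\\C&D\end{pmatrix}:Z\mapsto(AZ+B)(CZ+D)^{-1}.$$
   Context: $V$ is the complex vector space with countable basis $E=\{\dots,e_{-2},e_{-1};e_1,e_2,\dots\}$, hermitian form $h(e_i,e_j)=\delta_{i,j}$ for $i<0$, $h(e_i,e_j)=-\delta_{i,j}$ for $i>0$, and symmetric bilinear form $b(e_i,e_j)=\delta_{i+j,0}$ for all $i,j$. $V_+=\mathrm{Span}\{e_i\mid i<0\}$, $V_-=\mathrm{Span}\{e_i\mid i>0\}$, and $\pi_\pm:V\to V_\pm$ are the $h$-orthogonal projections. $G=SO(\infty;\mathbb C)$ is the group of linear transformations of $V$ of determinant $1$ preserving $b$ and fixing all but finitely many elements of $E$; $G_0=SO^*(\infty)$ is the subgroup of $G$ preserving $h$. Elements of $G_0$ are written in block form relative to $V=V_+\oplus V_-$. $\mathcal Z_{\mathcal F,E}=G(\mathcal F)$ is the complex flag manifold, and $D_0=G_0(\mathcal F)$ consists of the $(0,F^{(1)},V)\in\mathcal Z_{\mathcal F,E}$ with $F^{(1)}$ a maximal $h$-negative definite $b$-isotropic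 subspace of $V$. A linear map $Z:V_-\to V_+$ is finitary if its matrix has only finitely many nonzero entries. The matrix of $Z$ is $(z_{j,i})_{i,j>0}$ where $Z(e_i)=\sum_{j>0}z_{j,i}e_{-j}$; antisymmetric means $z_{j,i}=-z_{i,j}$; $Z^*$ is the conjugate transpose. *)

theory Defs
  imports "HOL-Analysis.Analysis" "Jordan_Normal_Form.Determinant"
begin

text \<open>Vectors are finitely supported coordinate families indexed by the nonzero integers,
  encoded as functions on \<^typ>\<open>int\<close> that vanish at 0.\<close>

typedef V = "{f :: int \<Rightarrow> complex. f 0 = 0 \<and> finite {i. f i \<noteq> 0}}"
  morphisms coord Abs_V
  by (rule exI[of _ "\<lambda>_. 0"]) simp

setup_lifting type_definition_V

lemma V_eqI: "(\<And>i. coord x i = coord y i) \<Longrightarrow> x = y"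
  by (simp add: coord_inject[symmetric] fun_eq_iff)

lemma coord_0_index [simp]: "coord x 0 = 0"
  using coord[of x] by simp

lemma finite_supp [simp]: "finite {i. coord x i \<noteq> 0}"
  using coord[of x] by simp

instantiation V :: ab_group_add
begin

lift_definition zero_V :: V is "\<lambda>_. 0" by simp

lift_definition plus_V :: "V \<Rightarrow> V \<Rightarrow> V" is "\<lambda>f g i. f i + g i"
proof -
  fix f g :: "int \<Rightarrow> complex"
  assume "f 0 = 0 \<and> finite {i. f i \<noteq> 0}" "g 0 = 0 \<and> finite {i. g i \<noteq> 0}"
  moreover have "{i. f i + g i \<noteq> 0} \<subseteq> {i. f i \<noteq> 0} \<union> {i. g i \<noteq> 0}" by auto
  ultimately show "f 0 + g 0 = 0 \<and> finite {i. f i + g i \<noteq> 0}"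
    by (auto intro: finite_subset)
qed

lift_definition uminus_V :: "V \<Rightarrow> V" is "\<lambda>f i. - f i" by simp

definition minus_V :: "V \<Rightarrow> V \<Rightarrow> V" where "minus_V x y = x + (- y)"

instance
proof
  fix x y z :: V
  show "x + y + z = x + (y + z)" by transfer (simp add: fun_eq_iff algebra_simps)
  show "x + y = y + x" by transfer (simp add: fun_eq_iff algebra_simps)
  show "0 + x = x" by transfer simp
  show "- x + x = 0" by transfer simp
  show "x - y = x + - y" by (rule minus_V_def)
qed

end

lift_definition scaleV :: "complex \<Rightarrow> V \<Rightarrow> V" is "\<lambda>c f i. c * f i"
  by simp

lemma coord_simps [simp]:
  "coord 0 i = 0" "coord (x + y) i = coord x i + coord y i"
  "coord (- x) i = - coord x i" "coord (x - y) i = coord x i - coord y i"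
  "coord (scaleV c x) i = c * coord x i"
  by (simp_all only: minus_V_def zero_V.rep_eq plus_V.rep_eq uminus_V.rep_eq scaleV.rep_eq
      add_uminus_conv_diff[of "coord x i"])

lemma vector_space_scaleV: "vector_space scaleV"
proof
  fix a b :: complex and x y :: V
  show "scaleV a (x + y) = scaleV a x + scaleV a y" by (rule V_eqI) (simp add: distrib_left)
  show "scaleV (a + b) x = scaleV a x + scaleV b x" by (rule V_eqI) (simp add: distrib_right)
  show "scaleV a (scaleV b x) = scaleV (a * b) x" by (rule V_eqI) simp
  show "scaleV 1 x = x" by (rule V_eqI) simp
qed

global_interpretation VS: vector_space scaleV
  by (rule vector_space_scaleV)

text \<open>The basis vectors are the \<open>e i\<close> with \<open>i \<noteq> 0\<close>; \<open>e 0\<close> is the zero vector.\<close>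

lift_definition e :: "int \<Rightarrow> V" is "\<lambda>i j. if j = i \<and> i \<noteq> 0 then 1 else 0"
proof -
  fix i :: int
  have "{j. (if j = i \<and> i \<noteq> 0 then 1 else 0 :: complex) \<noteq> 0} \<subseteq> {i}"
    by (rule subsetI) (simp split: if_splits)
  then show "(if 0 = i \<and> i \<noteq> 0 then 1 else 0) = (0 :: complex) \<and>
      finite {j. (if j = i \<and> i \<noteq> 0 then 1 else 0 :: complex) \<noteq> 0}"
    by (intro conjI) (simp, rule finite_subset, assumption, simp)
qed

lemma coord_e [simp]: "coord (e i) j = (if j = i \<and> i \<noteq> 0 then 1 else 0)"
  by (simp add: e.rep_eq)

definition supp :: "V \<Rightarrow> int set" where
  "supp x = {i. coord x i \<noteq> 0}"

definition hform :: "V \<Rightarrow> V \<Rightarrow> complex" where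
  "hform x y = (\<Sum>i\<in>supp x. (if i < 0 then 1 else - 1) * coord x i * cnj (coord y i))"

definition bform :: "V \<Rightarrow> V \<Rightarrow> complex" where
  "bform x y = (\<Sum>i\<in>supp x. coord x i * coord y (- i))"

lemma supp_e: "i \<noteq> 0 \<Longrightarrow> supp (e i) = {i}"
  by (auto simp: supp_def)

lemma hform_e:
  assumes "i \<noteq> 0" "j \<noteq> 0"
  shows "hform (e i) (e j) = (if i = j then (if i < 0 then 1 else - 1) else 0)"
  using assms by (auto simp: hform_def supp_e)

lemma bform_e:
  assumes "i \<noteq> 0" "j \<noteq> 0"
  shows "bform (e i) (e j) = (if i + j = 0 then 1 else 0)"
  using assms by (auto simp: bform_def supp_e)

definition Vplus :: "V set" where
  "Vplus = VS.span {e i | i. i < 0}"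

definition Vminus :: "V set" where
  "Vminus = VS.span {e i | i. i > 0}"

text \<open>The \<open>h\<close>-orthogonal projection onto \<open>W\<close>; it is used for \<^const>\<open>Vplus\<close> and
  \<^const>\<open>Vminus\<close> only, where it is well defined.\<close>

definition hproj :: "V set \<Rightarrow> V \<Rightarrow> V" where
  "hproj W x = (THE w. w \<in> W \<and> (\<forall>u\<in>W. hform (x - w) u = 0))"

abbreviation pi_plus :: "V \<Rightarrow> V" where "pi_plus \<equiv> hproj Vplus"
abbreviation pi_minus :: "V \<Rightarrow> V" where "pi_minus \<equiv> hproj Vminus"

text \<open>Determinant of a map \<open>g\<close> that fixes all but finitely many basis vectors: if \<open>g\<close> fixes every
  \<open>e i\<close> with \<open>\<bar>i\<bar> > n\<close>, it is the determinant of the \<open>2n \<times> 2n\<close> block of the matrix of \<open>g\<close> with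
  respect to \<open>e (-1), \<dots>, e (-n), e 1, \<dots>, e n\<close>. The value does not depend on \<open>n\<close>, as all columns
  of the matrix of \<open>g\<close> outside this block are those of the identity.\<close>

definition basis_index :: "nat \<Rightarrow> nat \<Rightarrow> int" where
  "basis_index n r = (if r < n then - int (r + 1) else int (r - n + 1))"

definition truncation :: "nat \<Rightarrow> (V \<Rightarrow> V) \<Rightarrow> complex mat" where
  "truncation n g =
     mat (2 * n) (2 * n) (\<lambda>(r, c). coord (g (e (basis_index n c))) (basis_index n r))"

definition fin_det :: "(V \<Rightarrow> V) \<Rightarrow> complex" where
  "fin_det g = Determinant.det (truncation (LEAST n. \<forall>i. \<bar>i\<bar> > int n \<longrightarrow> g (e i) = e i) g)"

definition G :: "(V \<Rightarrow> V) set" where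
  "G = {g. Vector_Spaces.linear scaleV scaleV g \<and> bij g \<and>
           finite {i. g (e i) \<noteq> e i} \<and> fin_det g = 1 \<and>
           (\<forall>x y. bform (g x) (g y) = bform x y)}"

definition G0 :: "(V \<Rightarrow> V) set" where
  "G0 = {g \<in> G. \<forall>x y. hform (g x) (g y) = hform x y}"

type_synonym flag = "V set \<times> V set \<times> V set"

definition flag_act :: "(V \<Rightarrow> V) \<Rightarrow> flag \<Rightarrow> flag" where
  "flag_act g = (\<lambda>(F0, F1, F2). (g ` F0, g ` F1, g ` F2))"

definition base_flag :: flag where
  "base_flag = ({0}, Vminus, UNIV)"

definition flag_manifold :: "flag set" where
  "flag_manifold = (\<lambda>g. flag_act g base_flag) ` G"

definition D0 :: "flag set" where
  "D0 = (\<lambda>g. flag_act g base_flag) ` G0"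

definition negative_isotropic :: "V set \<Rightarrow> bool" where
  "negative_isotropic W \<longleftrightarrow> VS.subspace W \<and>
     (\<forall>x\<in>W. x \<noteq> 0 \<longrightarrow> Re (hform x x) < 0) \<and> (\<forall>x\<in>W. \<forall>y\<in>W. bform x y = 0)"

definition maximal_negative_isotropic :: "V set \<Rightarrow> bool" where
  "maximal_negative_isotropic W \<longleftrightarrow> negative_isotropic W \<and>
     (\<forall>W'. negative_isotropic W' \<and> W \<subseteq> W' \<longrightarrow> W' = W)"

text \<open>Linear maps between subspaces, as extensional functions.\<close>

definition lin_maps :: "V set \<Rightarrow> V set \<Rightarrow> (V \<Rightarrow> V) set" where
  "lin_maps W W' = {f \<in> W \<rightarrow>\<^sub>E W'. (\<forall>x\<in>W. \<forall>y\<in>W. f (x + y) = f x + f y) \<and>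
                                    (\<forall>c. \<forall>x\<in>W. f (scaleV c x) = scaleV c (f x))}"

text \<open>Matrices have positive integers as indices; they are extended by 0 to all of \<^typ>\<open>int\<close>.\<close>

type_synonym imat = "int \<Rightarrow> int \<Rightarrow> complex"

definition matrix_of :: "(V \<Rightarrow> V) \<Rightarrow> imat" where
  "matrix_of Z j i = (if j > 0 \<and> i > 0 then coord (Z (e i)) (- j) else 0)"

definition finitary_mat :: "imat \<Rightarrow> bool" where
  "finitary_mat M \<longleftrightarrow> finite {(j, i). M j i \<noteq> 0}"

definition antisymmetric_mat :: "imat \<Rightarrow> bool" where
  "antisymmetric_mat M \<longleftrightarrow> (\<forall>i>0. \<forall>j>0. M j i = - M i j)"

definition conj_transpose :: "imat \<Rightarrow> imat" where
  "conj_transpose M i j = cnj (M j i)"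

definition one_imat :: imat where
  "one_imat k l = (if k = l \<and> k > 0 then 1 else 0)"

text \<open>Matrix product; the sum is finite if the columns of \<open>N\<close> have finite support.\<close>

definition imat_mult :: "imat \<Rightarrow> imat \<Rightarrow> imat" where
  "imat_mult M N k l = (\<Sum>j\<in>{j. N j l \<noteq> 0}. M k j * N j l)"

definition positive_definite_mat :: "imat \<Rightarrow> bool" where
  "positive_definite_mat M \<longleftrightarrow> (\<forall>x\<in>Vminus. x \<noteq> 0 \<longrightarrow>
     (let q = \<Sum>k\<in>supp x. \<Sum>l\<in>supp x. cnj (coord x k) * M k l * coord x l
      in Im q = 0 \<and> Re q > 0))"

definition skew_maps :: "(V \<Rightarrow> V) set" where
  "skew_maps = {Z \<in> lin_maps Vminus Vplus.
                  finitary_mat (matrix_of Z) \<and> antisymmetric_mat (matrix_of Z)}"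

definition Z_domain :: "(V \<Rightarrow> V) set" where
  "Z_domain = {Z \<in> skew_maps. positive_definite_mat
     (\<lambda>k l. one_imat k l - imat_mult (conj_transpose (matrix_of Z)) (matrix_of Z) k l)}"

text \<open>The infinite-dimensional space \<^const>\<open>skew_maps\<close> is the union of the finite-dimensional spaces
  \<open>skew_level n\<close> and carries the direct limit topology: a set is open iff its intersection with
  every \<open>skew_level n\<close> is open with respect to the matrix entries. A domain is a nonempty
  connected open set; boundedness refers to the operator norm of the norms \<open>vnorm\<close>, the
  Euclidean norms given by \<open>h\<close> on \<^const>\<open>Vplus\<close> and \<open>- h\<close> on \<^const>\<open>Vminus\<close>.\<close>

definition skew_level :: "nat \<Rightarrow> (V \<Rightarrow> V) set" where
  "skew_level n = {Z \<in> skew_maps. \<forall>j i. matrix_of Z j i \<noteq> 0 \<longrightarrow> j \<le> int n \<and> i \<le> int n}"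

definition skew_open :: "(V \<Rightarrow> V) set \<Rightarrow> bool" where
  "skew_open U \<longleftrightarrow> U \<subseteq> skew_maps \<and>
     (\<forall>n. openin (pullback_topology (skew_level n) matrix_of euclidean) (U \<inter> skew_level n))"

lemma istopology_skew_open: "istopology skew_open"
  unfolding istopology_def
proof (intro conjI allI impI)
  fix S T assume "skew_open S" "skew_open T"
  moreover have "S \<inter> T \<inter> skew_level n = (S \<inter> skew_level n) \<inter> (T \<inter> skew_level n)" for n
    by auto
  ultimately show "skew_open (S \<inter> T)"
    unfolding skew_open_def by (auto intro: openin_Int)
next
  fix K assume K: "\<forall>S\<in>K. skew_open S"
  show "skew_open (\<Union>K)"
    unfolding skew_open_def
  proof (intro conjI allI)
    show "\<Union>K \<subseteq> skew_maps" using K unfolding skew_open_def by blast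
    fix n
    have "openin (pullback_topology (skew_level n) matrix_of euclidean) (\<Union>S\<in>K. S \<inter> skew_level n)"
      using K unfolding skew_open_def by (intro openin_Union) blast
    then show "openin (pullback_topology (skew_level n) matrix_of euclidean) (\<Union>K \<inter> skew_level n)"
      by simp
  qed
qed

definition skew_topology :: "(V \<Rightarrow> V) topology" where
  "skew_topology = topology skew_open"

lemma openin_skew_topology: "openin skew_topology = skew_open"
  unfolding skew_topology_def using istopology_skew_open by (rule topology_inverse')

definition vnorm :: "V \<Rightarrow> real" where
  "vnorm x = sqrt (\<Sum>i\<in>supp x. (cmod (coord x i))\<^sup>2)"

definition bounded_domain :: "(V \<Rightarrow> V) set \<Rightarrow> bool" where
  "bounded_domain U \<longleftrightarrow> U \<noteq> {} \<and> openin skew_topology U \<and> connectedin skew_topology U \<and>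
     (\<exists>M. \<forall>Z\<in>U. \<forall>x\<in>Vminus. vnorm (Z x) \<le> M * vnorm x)"

text \<open>The map \<open>Z\<close> with \<open>Z (pi_minus x) = pi_plus x\<close> for \<open>x \<in> F1\<close>; it is well defined if
  \<^const>\<open>pi_minus\<close> maps \<open>F1\<close> bijectively to \<^const>\<open>Vminus\<close>.\<close>

definition realization :: "flag \<Rightarrow> (V \<Rightarrow> V)" where
  "realization = (\<lambda>(F0, F1, F2). \<lambda>y\<in>Vminus. THE w. \<exists>x\<in>F1. pi_minus x = y \<and> pi_plus x = w)"

definition block :: "V set \<Rightarrow> V set \<Rightarrow> (V \<Rightarrow> V) \<Rightarrow> (V \<Rightarrow> V)" where
  "block W' W g = (\<lambda>x\<in>W. hproj W' (g x))"

abbreviation "block_A \<equiv> block Vplus Vplus"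
abbreviation "block_B \<equiv> block Vplus Vminus"
abbreviation "block_C \<equiv> block Vminus Vplus"
abbreviation "block_D \<equiv> block Vminus Vminus"

text \<open>\<open>AZ + B : V\<^sub>- \<rightarrow> V\<^sub>+\<close> and \<open>CZ + D : V\<^sub>- \<rightarrow> V\<^sub>-\<close>\<close>

definition numer :: "(V \<Rightarrow> V) \<Rightarrow> (V \<Rightarrow> V) \<Rightarrow> (V \<Rightarrow> V)" where
  "numer g Z = (\<lambda>y\<in>Vminus. block_A g (Z y) + block_B g y)"

definition denom :: "(V \<Rightarrow> V) \<Rightarrow> (V \<Rightarrow> V) \<Rightarrow> (V \<Rightarrow> V)" where
  "denom g Z = (\<lambda>y\<in>Vminus. block_C g (Z y) + block_D g y)"

definition frac_act :: "(V \<Rightarrow> V) \<Rightarrow> (V \<Rightarrow> V) \<Rightarrow> (V \<Rightarrow> V)" where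
  "frac_act g Z = compose Vminus (numer g Z) (inv_into Vminus (denom g Z))"

end

theory Submission
  imports Defs
begin

text \<open>A negative isotropic subspace \<open>F = g V\<^sub>-\<close> meets \<open>V\<^sub>+\<close> trivially, so \<open>\<pi>\<^sub>- \<circ> g\<close> is injective on
  \<open>V\<^sub>-\<close>; since \<open>g\<close> moves only finitely many coordinates, it is also onto, and \<open>F\<close> is the graph of a
  finitary map \<open>Z\<close>. Isotropy of the graph is antisymmetry of \<open>Z\<close>, and its negativity is positivity of
  \<open>I - Z\<^sup>* Z\<close>. Conversely, Gram--Schmidt gives an \<open>h\<close>-orthonormal basis \<open>f\<^sub>i\<close> of such a graph with
  \<open>f\<^sub>i = e\<^sub>i\<close> for large \<open>i\<close>. With the antilinear map \<open>J\<close> satisfying \<open>b(x, y) = h(x, J y)\<close> and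
  \<open>J\<^sup>2 = -1\<close>, the rules \<open>e\<^sub>i \<mapsto> f\<^sub>i\<close> and \<open>e\<^sub>-\<^sub>i \<mapsto> J f\<^sub>i\<close> for \<open>i > 0\<close> define an isometry of both forms. Its
  determinant is 1 because it is the product of the unipotent map \<open>1 + Z\<close> and an element of the
  \<open>b\<close>-stabilizer of \<open>V\<^sub>-\<close>. The formula for the action is then the description of \<open>g\<close> applied to a
  graph. The domain is star-shaped about 0, and it is open by compactness of unit spheres.\<close>

subsection \<open>The two forms and linear maps in coordinates\<close>

lemma finite_supp_set [simp]: "finite (supp x)"
  by (simp add: supp_def)

lemma in_supp: "i \<in> supp x \<longleftrightarrow> coord x i \<noteq> 0"
  by (simp add: supp_def)

lemma V_eq_nonzeroI: "(\<And>i. i \<noteq> 0 \<Longrightarrow> coord x i = coord y i) \<Longrightarrow> x = y"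
  by (rule V_eqI) (metis coord_0_index)

lemma coord_sum: "coord (sum f S) i = (\<Sum>k\<in>S. coord (f k) i)"
  by (induction S rule: infinite_finite_induct) auto

lemma V_expand: "x = (\<Sum>i\<in>supp x. scaleV (coord x i) (e i))"
proof (rule V_eqI)
  fix i
  have "(\<Sum>k\<in>supp x. coord x k * (if i = k \<and> k \<noteq> 0 then 1 else 0)) =
      (\<Sum>k\<in>supp x. if k = i then coord x k else 0)"
    by (rule sum.cong) (auto simp: in_supp)
  then show "coord x i = coord (\<Sum>i\<in>supp x. scaleV (coord x i) (e i)) i"
    by (simp add: coord_sum in_supp)
qed

lemma span_e: "VS.span (e ` I) = {x. supp x \<subseteq> I}"
proof
  have "VS.subspace {x. supp x \<subseteq> I}"
    by (auto simp: VS.subspace_def in_supp subset_iff)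
      (metis add.right_neutral)
  moreover have "e ` I \<subseteq> {x. supp x \<subseteq> I}"
    by (auto simp: in_supp split: if_splits)
  ultimately show "VS.span (e ` I) \<subseteq> {x. supp x \<subseteq> I}"
    by (rule VS.span_minimal[rotated])
next
  show "{x. supp x \<subseteq> I} \<subseteq> VS.span (e ` I)"
  proof
    fix x assume "x \<in> {x. supp x \<subseteq> I}"
    then have "(\<Sum>i\<in>supp x. scaleV (coord x i) (e i)) \<in> VS.span (e ` I)"
      by (intro VS.span_sum VS.span_scale VS.span_base) auto
    then show "x \<in> VS.span (e ` I)" by (simp flip: V_expand)
  qed
qed

lemma Vplus_iff: "x \<in> Vplus \<longleftrightarrow> (\<forall>i>0. coord x i = 0)"
proof -
  have "{e i | i. i < 0} = e ` {..<0}" by auto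
  then have "x \<in> Vplus \<longleftrightarrow> supp x \<subseteq> {..<0}" by (simp add: Vplus_def span_e)
  also have "\<dots> \<longleftrightarrow> (\<forall>i>0. coord x i = 0)"
    by (auto simp: subset_iff in_supp) (metis coord_0_index linorder_neqE)
  finally show ?thesis .
qed

lemma Vminus_iff: "x \<in> Vminus \<longleftrightarrow> (\<forall>i<0. coord x i = 0)"
proof -
  have "{e i | i. i > 0} = e ` {0<..}" by auto
  then have "x \<in> Vminus \<longleftrightarrow> supp x \<subseteq> {0<..}" by (simp add: Vminus_def span_e)
  also have "\<dots> \<longleftrightarrow> (\<forall>i<0. coord x i = 0)"
    by (auto simp: subset_iff in_supp) (metis coord_0_index linorder_neqE)
  finally show ?thesis .
qed

lemma e_Vminus: "i > 0 \<Longrightarrow> e i \<in> Vminus"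
  by (auto simp: Vminus_iff)

lemma subspace_Vminus: "VS.subspace Vminus" and subspace_Vplus: "VS.subspace Vplus"
  by (simp_all add: Vminus_def Vplus_def)

text \<open>The definition sums over a support that varies with the first argument. A common finite
  index set is what lets values at different vectors be compared, as in additivity and
  symmetry.\<close>

lemma hform_sum:
  assumes "finite S" "supp x \<subseteq> S"
  shows "hform x y = (\<Sum>i\<in>S. (if i < 0 then 1 else - 1) * coord x i * cnj (coord y i))"
  unfolding hform_def using assms by (intro sum.mono_neutral_left) (auto simp: in_supp)

lemma bform_sum:
  assumes "finite S" "supp x \<subseteq> S"
  shows "bform x y = (\<Sum>i\<in>S. coord x i * coord y (- i))"
  unfolding bform_def using assms by (intro sum.mono_neutral_left) (auto simp: in_supp)

lemma supp_add: "supp (x + y) \<subseteq> supp x \<union> supp y" and supp_scale: "supp (scaleV c x) \<subseteq> supp x"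
  by (auto simp: in_supp)

lemma hform_add_left: "hform (x + y) z = hform x z + hform y z"
  using hform_sum[of "supp x \<union> supp y" x z] hform_sum[of "supp x \<union> supp y" y z]
    hform_sum[of "supp x \<union> supp y" "x + y" z] supp_add[of x y]
  by (simp add: algebra_simps sum.distrib)

lemma hform_scale_left: "hform (scaleV c x) z = c * hform x z"
  using hform_sum[of "supp x" x z] hform_sum[of "supp x" "scaleV c x" z] supp_scale[of c x]
  by (simp add: sum_distrib_left algebra_simps)

lemma hform_commute: "hform y x = cnj (hform x y)"
proof -
  have "hform y x = (\<Sum>i\<in>supp x \<union> supp y. (if i < 0 then 1 else - 1) * coord y i * cnj (coord x i))"
    by (rule hform_sum) auto
  moreover have "hform x y = (\<Sum>i\<in>supp x \<union> supp y. (if i < 0 then 1 else - 1) * coord x i * cnj (coord y i))"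
    by (rule hform_sum) auto
  ultimately show ?thesis by (simp add: cnj_sum) (rule sum.cong, auto)
qed

lemma hform_add_right: "hform z (x + y) = hform z x + hform z y"
  by (subst (1 2 3) hform_commute) (simp add: hform_add_left)

lemma hform_scale_right: "hform z (scaleV c x) = cnj c * hform z x"
  by (subst (1 2) hform_commute) (simp add: hform_scale_left)

lemma hform_zero [simp]: "hform 0 x = 0" "hform x 0 = 0"
  by (simp_all add: hform_def supp_def)

lemma bform_zero [simp]: "bform 0 x = 0" "bform x 0 = 0"
  by (simp_all add: bform_def supp_def)

lemma scaleV_minus_one: "scaleV (- 1) x = - x"
  by (rule V_eqI) simp

lemma hform_minus_right: "hform z (- x) = - hform z x"
  using hform_scale_right[of z "- 1" x] by (simp add: scaleV_minus_one)

lemma hform_sum_left: "hform (sum f S) z = (\<Sum>i\<in>S. hform (f i) z)"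
  by (induction S rule: infinite_finite_induct) (simp_all add: hform_add_left)

lemma hform_sum_right: "hform z (sum f S) = (\<Sum>i\<in>S. hform z (f i))"
  by (induction S rule: infinite_finite_induct) (simp_all add: hform_add_right)

lemma hform_e_right: "hform x (e i) = (if i < 0 then 1 else - 1) * coord x i"
proof -
  have "hform x (e i) = (\<Sum>k\<in>supp x. if k = i then (if i < 0 then 1 else - 1) * coord x i else 0)"
    unfolding hform_def by (rule sum.cong) (auto simp: in_supp)
  then show ?thesis by (simp add: in_supp)
qed

lemma hform_nondegenerate: "(\<And>y. hform x y = 0) \<Longrightarrow> x = 0"
  by (rule V_eqI) (metis hform_e_right mult_eq_0_iff coord_simps(1) neg_equal_0_iff_equal zero_neq_one)

text \<open>The quaternionic structure of V, antilinear with square -1. Its signs are forced by b(x,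
  y) = h(x, J y), and a bijection preserving both forms commutes with it.\<close>

lift_definition J :: "V \<Rightarrow> V" is "\<lambda>f i. (if i < 0 then 1 else - 1) * cnj (f (- i))"
proof -
  fix f :: "int \<Rightarrow> complex" assume f: "f 0 = 0 \<and> finite {i. f i \<noteq> 0}"
  have "{i. f (- i) \<noteq> 0} \<subseteq> uminus ` {i. f i \<noteq> 0}"
    by (force simp: image_iff)
  then have "finite {i. f (- i) \<noteq> 0}"
    using f finite_surj by blast
  with f show "(if 0 < (0::int) then 1 else - 1) * cnj (f (- 0)) = 0 \<and>
      finite {i::int. (if i < 0 then 1 else - 1) * cnj (f (- i)) \<noteq> 0}"
    by (auto elim!: rev_finite_subset)
qed

lemma coord_J: "coord (J x) i = (if i < 0 then 1 else - 1) * cnj (coord x (- i))"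
  by (simp add: J.rep_eq)

lemma bform_J: "bform x y = hform x (J y)"
  unfolding bform_def hform_def by (rule sum.cong) (auto simp: coord_J)

lemma J_J: "J (J x) = - x"
  by (rule V_eq_nonzeroI) (simp add: coord_J)

lemma J_add: "J (x + y) = J x + J y"
  by (rule V_eqI) (simp add: coord_J)

lemma J_scale: "J (scaleV c x) = scaleV (cnj c) (J x)"
  by (rule V_eqI) (simp add: coord_J)

lemma J_e: "i > 0 \<Longrightarrow> J (e i) = e (- i)"
  by (rule V_eqI) (auto simp: coord_J)

lemma bform_add_left: "bform (x + y) z = bform x z + bform y z"
  by (simp add: bform_J hform_add_left)

lemma bform_add_right: "bform z (x + y) = bform z x + bform z y"
  by (simp add: bform_J J_add hform_add_right)

lemma bform_scale_left: "bform (scaleV c x) z = c * bform x z"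
  by (simp add: bform_J hform_scale_left)

lemma bform_scale_right: "bform z (scaleV c x) = c * bform z x"
  by (simp add: bform_J J_scale hform_scale_right)

lemma bform_sum_left: "bform (sum f S) z = (\<Sum>i\<in>S. bform (f i) z)"
  by (simp add: bform_J hform_sum_left)

lemma bform_sum_right: "bform z (sum f S) = (\<Sum>i\<in>S. bform z (f i))"
  by (induction S rule: infinite_finite_induct) (simp_all add: bform_add_right)

lemma bform_commute: "bform y x = bform x y"
proof -
  \<comment> \<open>This index set is closed under negation, so i |-> -i permutes it and exchanges
    the two arguments.\<close>
  let ?S = "supp x \<union> supp y \<union> uminus ` (supp x \<union> supp y)"
  have "bform y x = (\<Sum>i\<in>?S. coord y i * coord x (- i))"
    by (rule bform_sum) auto
  also have "\<dots> = (\<Sum>i\<in>?S. coord y (- i) * coord x i)"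
    by (rule sum.reindex_bij_witness[of _ uminus uminus]) (auto simp: image_iff)
  also have "\<dots> = bform x y"
    by (subst bform_sum[of ?S]) (auto simp: mult.commute)
  finally show ?thesis .
qed

lemma bform_e_right: "bform x (e i) = coord x (- i)"
proof (cases "i = 0")
  case False
  have "bform x (e i) = (\<Sum>k\<in>supp x. if k = - i then coord x (- i) else 0)"
    unfolding bform_def using False by (intro sum.cong) (auto simp: in_supp)
  then show ?thesis by (simp add: in_supp)
qed (auto simp: bform_def)

lemma bform_e_left: "bform (e i) x = coord x (- i)"
  by (simp add: bform_commute[of "e i"] bform_e_right)

section \<open>The projections onto V_+ and V_-\<close>

lemma ex_V_restrict: "\<exists>w. \<forall>i. coord w i = (if P i then coord x i else 0)"
proof
  show "\<forall>i. coord (\<Sum>k\<in>{k\<in>supp x. P k}. scaleV (coord x k) (e k)) i = (if P i then coord x i else 0)"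
  proof
    fix i
    have "(\<Sum>k\<in>{k\<in>supp x. P k}. coord x k * (if i = k \<and> k \<noteq> 0 then 1 else 0)) =
        (\<Sum>k\<in>{k\<in>supp x. P k}. if k = i then coord x k else 0)"
      by (rule sum.cong) (auto simp: in_supp)
    then show "coord (\<Sum>k\<in>{k\<in>supp x. P k}. scaleV (coord x k) (e k)) i = (if P i then coord x i else 0)"
      by (simp add: coord_sum in_supp)
  qed
qed

text \<open>Cutting off coordinates provides a vector with the defining property of
  \<open>hproj\<close>; testing against the \<open>e i\<close> of the subspace shows that it is the
  only one, which evaluates the description operator.\<close>

lemma coord_pi_plus: "coord (pi_plus x) i = (if i < 0 then coord x i else 0)"
proof -
  obtain w where w: "\<And>i. coord w i = (if i < 0 then coord x i else 0)"
    using ex_V_restrict[of "\<lambda>i. i < 0" x] by blast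
  have "pi_plus x = w"
    unfolding hproj_def
  proof (rule the_equality)
    show "w \<in> Vplus \<and> (\<forall>u\<in>Vplus. hform (x - w) u = 0)"
      by (auto simp: Vplus_iff w hform_def intro!: sum.neutral)
        (metis coord_0_index less_linear)
  next
    fix v assume v: "v \<in> Vplus \<and> (\<forall>u\<in>Vplus. hform (x - v) u = 0)"
    show "v = w"
    proof (rule V_eqI)
      fix i
      show "coord v i = coord w i"
      proof (cases "i < 0")
        case True
        then have "e i \<in> Vplus" by (auto simp: Vplus_iff)
        with v have "hform (x - v) (e i) = 0" by blast
        with True show ?thesis by (simp add: hform_e_right w)
      next
        case False
        with v show ?thesis by (cases "i = 0") (auto simp: Vplus_iff w)
      qed
    qed
  qed
  with w show ?thesis by simp
qed

lemma coord_pi_minus: "coord (pi_minus x) i = (if i > 0 then coord x i else 0)"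
proof -
  obtain w where w: "\<And>i. coord w i = (if i > 0 then coord x i else 0)"
    using ex_V_restrict[of "\<lambda>i. i > 0" x] by blast
  have "pi_minus x = w"
    unfolding hproj_def
  proof (rule the_equality)
    show "w \<in> Vminus \<and> (\<forall>u\<in>Vminus. hform (x - w) u = 0)"
      by (auto simp: Vminus_iff w hform_def intro!: sum.neutral)
  next
    fix v assume v: "v \<in> Vminus \<and> (\<forall>u\<in>Vminus. hform (x - v) u = 0)"
    show "v = w"
    proof (rule V_eqI)
      fix i
      show "coord v i = coord w i"
      proof (cases "i > 0")
        case True
        then have "e i \<in> Vminus" by (auto simp: Vminus_iff)
        with v have "hform (x - v) (e i) = 0" by blast
        with True show ?thesis by (simp add: hform_e_right w)
      next
        case False
        with v show ?thesis by (cases "i = 0") (auto simp: Vminus_iff w)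
      qed
    qed
  qed
  with w show ?thesis by simp
qed

lemma pi_plus_in [simp]: "pi_plus x \<in> Vplus" and pi_minus_in [simp]: "pi_minus x \<in> Vminus"
  by (auto simp: Vplus_iff Vminus_iff coord_pi_plus coord_pi_minus)

lemma pi_decomp: "pi_minus x + pi_plus x = x"
  by (rule V_eq_nonzeroI) (auto simp: coord_pi_plus coord_pi_minus)

lemma pi_add: "pi_minus (x + y) = pi_minus x + pi_minus y" "pi_plus (x + y) = pi_plus x + pi_plus y"
  by (rule V_eqI; simp add: coord_pi_plus coord_pi_minus)+

lemma pi_scale: "pi_minus (scaleV c x) = scaleV c (pi_minus x)" "pi_plus (scaleV c x) = scaleV c (pi_plus x)"
  by (rule V_eqI; simp add: coord_pi_plus coord_pi_minus)+

lemma pi_on_Vminus: "x \<in> Vminus \<Longrightarrow> pi_minus x = x" "x \<in> Vminus \<Longrightarrow> pi_plus x = 0"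
  by (rule V_eq_nonzeroI; auto simp: coord_pi_plus coord_pi_minus Vminus_iff)+

lemma pi_on_Vplus: "x \<in> Vplus \<Longrightarrow> pi_plus x = x" "x \<in> Vplus \<Longrightarrow> pi_minus x = 0"
  by (rule V_eq_nonzeroI; auto simp: coord_pi_plus coord_pi_minus Vplus_iff)+

section \<open>Linear maps given by their values on the basis\<close>

lemma linear_iff:
  "Vector_Spaces.linear scaleV scaleV g \<longleftrightarrow>
     (\<forall>x y. g (x + y) = g x + g y) \<and> (\<forall>c x. g (scaleV c x) = scaleV c (g x))"
  by (auto simp: Vector_Spaces.linear_def module_hom_def module_hom_axioms_def
      VS.module_axioms vector_space_scaleV)

abbreviation lin :: "(V \<Rightarrow> V) \<Rightarrow> bool" where
  "lin \<equiv> Vector_Spaces.linear scaleV scaleV"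

lemma lin_add: "lin g \<Longrightarrow> g (x + y) = g x + g y"
  and lin_scale: "lin g \<Longrightarrow> g (scaleV c x) = scaleV c (g x)"
  by (simp_all add: linear_iff)

lemma lin_zero: "lin g \<Longrightarrow> g 0 = 0"
  using lin_scale[of g 0 0] by simp

lemma lin_diff: "lin g \<Longrightarrow> g (x - y) = g x - g y"
  by (metis add_diff_cancel_right' diff_add_cancel lin_add)

lemma lin_sum: "lin g \<Longrightarrow> g (sum f S) = (\<Sum>i\<in>S. g (f i))"
  by (induction S rule: infinite_finite_induct) (simp_all add: lin_zero lin_add)

lemma lin_expand:
  assumes "lin g"
  shows "g x = (\<Sum>i\<in>supp x. scaleV (coord x i) (g (e i)))"
proof -
  have "g x = g (\<Sum>i\<in>supp x. scaleV (coord x i) (e i))" by (simp flip: V_expand)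
  also have "\<dots> = (\<Sum>i\<in>supp x. scaleV (coord x i) (g (e i)))"
    by (simp add: lin_sum[OF assms] lin_scale[OF assms])
  finally show ?thesis .
qed

lemma ex_lin:
  obtains g where "lin g" "\<And>i. i \<noteq> 0 \<Longrightarrow> g (e i) = \<phi> i"
proof
  define g where "g x = (\<Sum>i\<in>supp x. scaleV (coord x i) (\<phi> i))" for x
  \<comment> \<open>The sum may run over any finite set containing the support, so x, y and x + y
    can share one index set.\<close>
  have g: "g x = (\<Sum>i\<in>S. scaleV (coord x i) (\<phi> i))" if "finite S" "supp x \<subseteq> S" for x S
    unfolding g_def using that by (intro sum.mono_neutral_left) (auto simp: in_supp)
  show "lin g"
    unfolding linear_iff
  proof (intro conjI allI)
    fix x y
    show "g (x + y) = g x + g y"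
      using g[of "supp x \<union> supp y" x] g[of "supp x \<union> supp y" y] g[of "supp x \<union> supp y" "x + y"]
        supp_add[of x y] by (simp add: VS.scale_left_distrib sum.distrib)
  next
    fix c x
    show "g (scaleV c x) = scaleV c (g x)"
      using g[of "supp x" x] g[of "supp x" "scaleV c x"] supp_scale[of c x]
      by (simp add: VS.scale_sum_right)
  qed
  show "g (e i) = \<phi> i" if "i \<noteq> 0" for i
    using that by (simp add: g_def supp_e)
qed

lemma lin_hform:
  assumes "lin g" "\<And>i j. i \<noteq> 0 \<Longrightarrow> j \<noteq> 0 \<Longrightarrow> hform (g (e i)) (g (e j)) = hform (e i) (e j)"
  shows "hform (g x) (g y) = hform x y"
proof -
  have nz: "i \<noteq> 0" if "i \<in> supp z" for i z using that by (metis coord_0_index in_supp)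
  have lhs: "hform (g x) (g y) = (\<Sum>i\<in>supp x. \<Sum>j\<in>supp y. cnj (coord y j) * (coord x i * hform (g (e i)) (g (e j))))"
    by (simp only: lin_expand[OF assms(1), of x] lin_expand[OF assms(1), of y] hform_sum_left)
      (simp add: hform_sum_right hform_scale_left hform_scale_right sum_distrib_left)
  have rhs: "hform x y = (\<Sum>i\<in>supp x. \<Sum>j\<in>supp y. cnj (coord y j) * (coord x i * hform (e i) (e j)))"
    by (subst V_expand[of x], subst V_expand[of y], simp only: hform_sum_left)
      (simp add: hform_sum_right hform_scale_left hform_scale_right sum_distrib_left)
  show ?thesis unfolding lhs rhs by (intro sum.cong refl) (simp add: assms(2) nz)
qed

lemma lin_bform:
  assumes "lin g" "\<And>i j. i \<noteq> 0 \<Longrightarrow> j \<noteq> 0 \<Longrightarrow> bform (g (e i)) (g (e j)) = bform (e i) (e j)"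
  shows "bform (g x) (g y) = bform x y"
proof -
  have nz: "i \<noteq> 0" if "i \<in> supp z" for i z using that by (metis coord_0_index in_supp)
  have lhs: "bform (g x) (g y) = (\<Sum>i\<in>supp x. \<Sum>j\<in>supp y. coord y j * (coord x i * bform (g (e i)) (g (e j))))"
    by (simp only: lin_expand[OF assms(1), of x] lin_expand[OF assms(1), of y] bform_sum_left)
      (simp add: bform_sum_right bform_scale_left bform_scale_right sum_distrib_left)
  have rhs: "bform x y = (\<Sum>i\<in>supp x. \<Sum>j\<in>supp y. coord y j * (coord x i * bform (e i) (e j)))"
    by (subst V_expand[of x], subst V_expand[of y], simp only: bform_sum_left)
      (simp add: bform_sum_right bform_scale_left bform_scale_right sum_distrib_left)
  show ?thesis unfolding lhs rhs by (intro sum.cong refl) (simp add: assms(2) nz)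
qed

text \<open>On the span of the 2n basis vectors of the block an injective endomorphism is onto by
  counting dimensions; all other basis vectors are fixed.\<close>

lemma lin_inj_surj:
  assumes g: "lin g" "inj g" and fx: "\<And>i. \<bar>i\<bar> > int n \<Longrightarrow> g (e i) = e i"
    and pres: "\<And>i. \<bar>i\<bar> \<le> int n \<Longrightarrow> supp (g (e i)) \<subseteq> {- int n..int n}"
  shows "surj g"
proof -
  define I where "I = {- int n..int n} - {0}"
  have finI: "finite I" by (simp add: I_def)
  have inje: "inj_on e I"
    by (rule inj_onI) (metis coord_e I_def Diff_iff insertI1 zero_neq_one)
  have ind: "VS.independent (e ` I)"
    unfolding VS.independent_explicit_finite_subsets
  proof (intro allI impI ballI)
    fix A u v assume A: "A \<subseteq> e ` I" "finite A" and 0: "(\<Sum>v\<in>A. scaleV (u v) v) = 0" and "v \<in> A"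
    then obtain i where i: "i \<in> I" "v = e i" by auto
    have coord: "coord w i = (if w = v then 1 else 0)" if "w \<in> A" for w
    proof -
      obtain j where "j \<in> I" "w = e j" using \<open>w \<in> A\<close> A by blast
      with i inje show ?thesis by (auto simp: I_def inj_on_def)
    qed
    have "0 = coord (\<Sum>v\<in>A. scaleV (u v) v) i" by (simp add: 0)
    also have "\<dots> = (\<Sum>w\<in>A. if w = v then u v else 0)"
      unfolding coord_sum by (intro sum.cong) (auto simp: coord)
    finally show "u v = 0" using \<open>v \<in> A\<close> A by simp
  qed
  interpret Vector_Spaces.linear scaleV scaleV g by (rule g(1))
  have sub: "VS.subspace (range g)" by (rule subspace_image) (rule VS.subspace_UNIV)
  let ?S = "g ` e ` I"
  have indS: "VS.independent ?S"
    using independent_injective_image[OF ind] g(2) by (simp add: inj_on_subset)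
  have gI: "g ` e ` I \<subseteq> VS.span (e ` I)"
  proof (rule image_subsetI)
    fix w assume "w \<in> e ` I"
    then obtain i where "i \<in> I" "w = e i" by blast
    then have "\<bar>i\<bar> \<le> int n" "w = e i" by (auto simp: I_def)
    with pres have "supp (g w) \<subseteq> {- int n..int n}" by simp
    moreover have "0 \<notin> supp (g w)" by (simp add: in_supp)
    ultimately show "g w \<in> VS.span (e ` I)" by (auto simp: span_e I_def)
  qed
  have card: "card ?S = card (e ` I)"
    using g(2) by (simp add: card_image inj_on_subset)
  have "e i \<in> VS.span ?S" if "i \<in> I" for i
  proof (rule ccontr)
    assume notin: "e i \<notin> VS.span ?S"
    \<comment> \<open>If \<open>e i\<close> were missed, it would join the images to form more
      independent vectors than the number of vectors spanning the block.\<close>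
    have "VS.independent (insert (e i) ?S)"
      using VS.independent_insertI[OF notin indS] .
    moreover have "insert (e i) ?S \<subseteq> VS.span (e ` I)"
      using gI \<open>i \<in> I\<close> VS.span_base by blast
    ultimately have "card (insert (e i) ?S) \<le> card (e ` I)"
      using VS.independent_span_bound[of "e ` I"] finI by blast
    moreover have "e i \<notin> ?S" by (rule contra_subsetD[OF VS.span_superset notin])
    moreover have "finite ?S" using finI by blast
    ultimately show False using card by (metis card_insert_disjoint Suc_n_not_le_n)
  qed
  moreover have "VS.span ?S \<subseteq> range g"
    by (rule VS.span_minimal[OF _ sub]) blast
  ultimately have I: "e i \<in> range g" if "i \<in> I" for i
    using that by blast
  have range: "e i \<in> range g" for i
  proof (cases "i \<in> I")
    case True
    then show ?thesis by (rule I)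
  next
    case False
    then consider "i = 0" | "\<bar>i\<bar> > int n" by (auto simp: I_def)
    then show ?thesis
    proof cases
      case 1
      \<comment> \<open>By convention \<open>e 0\<close> is the zero vector.\<close>
      then have "e i = g 0" by (simp add: zero) (rule V_eqI, simp)
      then show ?thesis by blast
    next
      case 2
      then show ?thesis using fx by (metis rangeI)
    qed
  qed
  have "y \<in> range g" for y
  proof -
    have "(\<Sum>i\<in>supp y. scaleV (coord y i) (e i)) \<in> range g"
      using range by (intro VS.subspace_sum[OF sub] VS.subspace_scale[OF sub]) auto
    then show ?thesis by (simp flip: V_expand)
  qed
  then show ?thesis by blast
qed

subsection \<open>The determinant and the groups\<close>

definition fixes_beyond :: "nat \<Rightarrow> (V \<Rightarrow> V) \<Rightarrow> bool" where
  "fixes_beyond n g \<longleftrightarrow> (\<forall>i. \<bar>i\<bar> > int n \<longrightarrow> g (e i) = e i)"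

lemma fixes_beyond_mono: "fixes_beyond m g \<Longrightarrow> m \<le> n \<Longrightarrow> fixes_beyond n g"
  by (auto simp: fixes_beyond_def)

lemma det_unit_column:
  fixes A :: "complex mat"
  assumes A: "A \<in> carrier_mat m m" and j: "j < m"
    and unit: "\<And>i. i < m \<Longrightarrow> A $$ (i, j) = (if i = j then 1 else 0)"
  shows "Determinant.det A = Determinant.det (mat_delete A j j)"
proof -
  have "Determinant.det A = (\<Sum>i<m. A $$ (i, j) * cofactor A i j)"
    by (rule laplace_expansion_column[OF A j])
  also have "\<dots> = (\<Sum>i<m. if i = j then cofactor A j j else 0)"
    by (rule sum.cong) (auto simp: unit)
  also have "\<dots> = Determinant.det (mat_delete A j j)"
    using j by (simp add: cofactor_def flip: mult_2)
  finally show ?thesis .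
qed

text \<open>In the order e(-1), ..., e(-n-1), e(1), ..., e(n+1), counted from 0, the two new basis
  vectors stand at positions n and 2n+1. Their columns are unit columns, so deleting both rows and
  columns keeps the determinant. The last position is deleted first so that position n does not
  shift.\<close>

lemma det_truncation_Suc:
  assumes g: "fixes_beyond n g"
  shows "Determinant.det (truncation (Suc n) g) = Determinant.det (truncation n g)"
proof -
  let ?A = "truncation (Suc n) g" and ?j = "Suc (2 * n)"
  have idx: "basis_index (Suc n) ?j = int n + 1" "basis_index (Suc n) n = - int n - 1"
    by (simp_all add: basis_index_def)
  have fixed: "g (e (int n + 1)) = e (int n + 1)" "g (e (- int n - 1)) = e (- int n - 1)"
    using g by (simp_all add: fixes_beyond_def)
  have idx_iff: "basis_index (Suc n) r = int n + 1 \<longleftrightarrow> r = ?j"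
    "basis_index (Suc n) r = - int n - 1 \<longleftrightarrow> r = n" for r
    unfolding basis_index_def by (cases "r < Suc n"; simp; linarith)+
  have A: "?A \<in> carrier_mat (2 * Suc n) (2 * Suc n)"
    by (simp add: truncation_def)
  have col: "?A $$ (r, ?j) = (if r = ?j then 1 else 0)" "?A $$ (r, n) = (if r = n then 1 else 0)"
    if "r < 2 * Suc n" for r
    using that by (simp_all add: truncation_def idx fixed idx_iff)
  have "Determinant.det ?A = Determinant.det (mat_delete ?A ?j ?j)"
    by (rule det_unit_column[OF A]) (simp_all add: col)
  also have "\<dots> = Determinant.det (mat_delete (mat_delete ?A ?j ?j) n n)"
  proof -
    have B: "mat_delete ?A ?j ?j \<in> carrier_mat ?j ?j"
      using mat_delete_carrier[OF A, of ?j ?j] by simp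
    have "mat_delete ?A ?j ?j $$ (r, n) = (if r = n then 1 else 0)" if "r < ?j" for r
    proof -
      have "mat_delete ?A ?j ?j $$ (r, n) = ?A $$ (r, n)"
        using that by (simp add: mat_delete_def truncation_def)
      then show ?thesis using that col(2)[of r] by simp
    qed
    then show ?thesis by (intro det_unit_column[OF B]) simp_all
  qed
  also have "mat_delete (mat_delete ?A ?j ?j) n n = truncation n g"
  proof (rule eq_matI)
    have shift: "basis_index (Suc n) (if r < n then r else Suc r) = basis_index n r" for r
      by (simp add: basis_index_def)
    fix r c assume "r < dim_row (truncation n g)" "c < dim_col (truncation n g)"
    then have rc: "r < 2 * n" "c < 2 * n" by (simp_all add: truncation_def)
    let ?r = "if r < n then r else Suc r" and ?c = "if c < n then c else Suc c"
    have lt: "?r < ?j" "?c < ?j" using rc by simp_all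
    have "mat_delete (mat_delete ?A ?j ?j) n n $$ (r, c) = mat_delete ?A ?j ?j $$ (?r, ?c)"
      using rc by (simp only: mat_delete_def) (simp add: truncation_def)
    also have "\<dots> = ?A $$ (?r, ?c)"
      using lt by (simp only: mat_delete_def) (simp add: truncation_def)
    also have "\<dots> = truncation n g $$ (r, c)"
    proof -
      have "?A $$ (?r, ?c) = coord (g (e (basis_index (Suc n) ?c))) (basis_index (Suc n) ?r)"
        using lt unfolding truncation_def by (subst index_mat) auto
      then show ?thesis unfolding shift using rc by (simp add: truncation_def)
    qed
    finally show "mat_delete (mat_delete ?A ?j ?j) n n $$ (r, c) = truncation n g $$ (r, c)" .
  qed (simp_all add: truncation_def mat_delete_def)
  finally show ?thesis .
qed

text \<open>Climbing from the least admissible block by unit enlargements frees the determinant from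
  the choice of n, so that several maps can be treated in one common block.\<close>

lemma fin_det_eq:
  assumes "fixes_beyond n g"
  shows "fin_det g = Determinant.det (truncation n g)"
proof -
  let ?m = "LEAST n. fixes_beyond n g"
  have m: "fixes_beyond ?m g" "?m \<le> n"
    using assms by (auto intro: LeastI Least_le)
  have "Determinant.det (truncation n g) = Determinant.det (truncation ?m g)"
    using m(2)
  proof (induction n rule: dec_induct)
    case (step k)
    then show ?case using det_truncation_Suc[OF fixes_beyond_mono[OF m(1)]] by simp
  qed simp
  then show ?thesis by (simp add: fin_det_def fixes_beyond_def)
qed

lemma bij_basis_index: "bij_betw (basis_index n) {0..<2 * n} ({- int n..int n} - {0})"
  by (rule bij_betw_byWitness[where f' = "\<lambda>i. if i < 0 then nat (- i - 1) else nat (i + int n - 1)"])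
    (auto simp: basis_index_def)

text \<open>Matrix multiplication inside the block is complete because the columns of
  \<open>k\<close> in the block have no entries outside it.\<close>

lemma truncation_comp:
  assumes g: "lin g" and k: "\<And>i. \<bar>i\<bar> \<le> int n \<Longrightarrow> supp (k (e i)) \<subseteq> {- int n..int n}"
  shows "truncation n (g \<circ> k) = truncation n g * truncation n k"
proof (rule eq_matI)
  fix r c assume "r < dim_row (truncation n g * truncation n k)"
    "c < dim_col (truncation n g * truncation n k)"
  then have rc: "r < 2 * n" "c < 2 * n" by (auto simp: truncation_def)
  let ?r = "basis_index n r" and ?x = "k (e (basis_index n c))" and ?I = "{- int n..int n} - {0}"
  have "basis_index n c \<in> ?I"
    using bij_betw_apply[OF bij_basis_index, of c n] rc by simp
  then have "supp ?x \<subseteq> ?I"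
    using k[of "basis_index n c"] by (auto simp: abs_le_iff subset_iff in_supp)
  then have "coord (g ?x) ?r = (\<Sum>i\<in>?I. coord (g (e i)) ?r * coord ?x i)"
    by (subst lin_expand[OF g]) (auto simp: coord_sum in_supp mult.commute intro!: sum.mono_neutral_left)
  also have "\<dots> = (\<Sum>j\<in>{0..<2 * n}. coord (g (e (basis_index n j))) ?r * coord ?x (basis_index n j))"
    by (rule sum.reindex_bij_betw[OF bij_basis_index, symmetric])
  finally show "truncation n (g \<circ> k) $$ (r, c) = (truncation n g * truncation n k) $$ (r, c)"
    using rc by (simp add: truncation_def scalar_prod_def)
qed (simp_all add: truncation_def)

text \<open>Coordinate j is the pairing with e(-j). For |j| > n that vector is fixed, so invariance
  of b shows that x and g x have the same coordinate j.\<close>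

lemma supp_isometry:
  assumes "fixes_beyond n g" and b: "\<And>x y. bform (g x) (g y) = bform x y" and "supp x \<subseteq> {- int n..int n}"
  shows "supp (g x) \<subseteq> {- int n..int n}"
proof
  fix j assume "j \<in> supp (g x)"
  show "j \<in> {- int n..int n}"
  proof (rule ccontr)
    assume j: "j \<notin> {- int n..int n}"
    have "coord (g x) j = bform (g x) (e (- j))" by (simp add: bform_e_right)
    also have "\<dots> = bform (g x) (g (e (- j)))"
      using assms(1) j by (auto simp: fixes_beyond_def abs_less_iff)
    also have "\<dots> = coord x j" by (simp add: b bform_e_right)
    also have "\<dots> = 0" using assms(3) j by (auto simp: in_supp)
    finally show False using \<open>j \<in> supp (g x)\<close> by (simp add: in_supp)
  qed
qed

lemma supp_isometry_e:
  assumes "fixes_beyond n g" "\<And>x y. bform (g x) (g y) = bform x y" "\<bar>i\<bar> \<le> int n"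
  shows "supp (g (e i)) \<subseteq> {- int n..int n}"
  by (rule supp_isometry[OF assms(1,2)]) (use assms(3) in \<open>auto simp: in_supp split: if_splits\<close>)

lemma fin_det_comp:
  assumes "lin g" "fixes_beyond n g" "fixes_beyond n k" "\<And>x y. bform (k x) (k y) = bform x y"
  shows "fin_det (g \<circ> k) = fin_det g * fin_det k"
proof -
  have gk: "fixes_beyond n (g \<circ> k)" using assms(2,3) by (simp add: fixes_beyond_def)
  have "truncation n (g \<circ> k) = truncation n g * truncation n k"
    using assms by (intro truncation_comp supp_isometry_e)
  then show ?thesis
    unfolding fin_det_eq[OF gk] fin_det_eq[OF assms(2)] fin_det_eq[OF assms(3)]
    using det_mult[of "truncation n g" "2 * n" "truncation n k"] by (simp add: truncation_def)
qed

text \<open>\<open>basis_index\<close> lists V_+ before V_-, so these are the finite parts of the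
  blocks A, B, C, D.\<close>

lemma truncation_four_block:
  "truncation n g = four_block_mat
     (mat n n (\<lambda>(r, c). coord (g (e (- int c - 1))) (- int r - 1)))
     (mat n n (\<lambda>(r, c). coord (g (e (int c + 1))) (- int r - 1)))
     (mat n n (\<lambda>(r, c). coord (g (e (- int c - 1))) (int r + 1)))
     (mat n n (\<lambda>(r, c). coord (g (e (int c + 1))) (int r + 1)))"
proof -
  have idx: "basis_index n r = (if r < n then - int r - 1 else int (r - n) + 1)" for r
    by (simp add: basis_index_def)
  show ?thesis
    by (intro eq_matI) (simp_all add: truncation_def idx)
qed

text \<open>The stabilizer of the isotropic subspace \<^const>\<open>Vminus\<close> is block triangular with diagonal blocks
  that are inverse transposes of each other.\<close>

lemma fin_det_stabilizer:
  assumes fx: "fixes_beyond n g" and b: "\<And>x y. bform (g x) (g y) = bform x y"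
    and stab: "\<And>x. x \<in> Vminus \<Longrightarrow> g x \<in> Vminus"
  shows "fin_det g = 1"
proof -
  let ?A = "mat n n (\<lambda>(r, c). coord (g (e (- int c - 1))) (- int r - 1))"
  let ?C = "mat n n (\<lambda>(r, c). coord (g (e (- int c - 1))) (int r + 1))"
  let ?D = "mat n n (\<lambda>(r, c). coord (g (e (int c + 1))) (int r + 1))"
  have gV: "g (e (int c + 1)) \<in> Vminus" for c
    by (intro stab e_Vminus) simp
  then have "mat n n (\<lambda>(r, c). coord (g (e (int c + 1))) (- int r - 1)) = 0\<^sub>m n n"
    by (intro eq_matI) (simp_all add: Vminus_iff)
  then have "truncation n g = four_block_mat ?A (0\<^sub>m n n) ?C ?D"
    using truncation_four_block[of n g] by simp
  then have "Determinant.det (truncation n g) = Determinant.det ?A * Determinant.det ?D"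
    using det_four_block_mat_upper_right_zero[of ?A n "0\<^sub>m n n" n ?C ?D] by simp
  also have "\<dots> = Determinant.det (transpose_mat ?A * ?D)"
    using det_mult[of "transpose_mat ?A" n ?D] det_transpose[of ?A n] by simp
  also have "transpose_mat ?A * ?D = 1\<^sub>m n"
  proof (rule eq_matI)
    fix i j assume ij: "i < dim_row (1\<^sub>m n :: complex mat)" "j < dim_col (1\<^sub>m n :: complex mat)"
    \<comment> \<open>The (i, j) entry is b(?x, ?y): since ?x lies in V_-, the pairing sees only the
      V_+ coordinates of ?y, which form a column of the block A. Invariance of b then gives the
      identity matrix.\<close>
    let ?x = "g (e (int j + 1))" and ?y = "g (e (- int i - 1))"
    have "supp ?x \<subseteq> {- int n..int n}"
      using ij by (intro supp_isometry_e[OF fx b]) auto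
    then have "k \<in> {1..int n}" if "k \<in> supp ?x" for k
      using gV[of j] that by (cases "k = 0"; cases "k < 0") (auto simp: Vminus_iff in_supp)
    then have "bform ?x ?y = (\<Sum>k\<in>{1..int n}. coord ?x k * coord ?y (- k))"
      by (intro bform_sum) auto
    also have "\<dots> = (\<Sum>r\<in>{0..<n}. coord ?x (int r + 1) * coord ?y (- int r - 1))"
      by (rule sum.reindex_bij_witness[of _ "\<lambda>r. int r + 1" "\<lambda>k. nat (k - 1)"]) auto
    finally have "(transpose_mat ?A * ?D) $$ (i, j) = bform ?x ?y"
      using ij by (simp add: scalar_prod_def mult.commute)
    also have "\<dots> = (1\<^sub>m n :: complex mat) $$ (i, j)"
      using ij by (auto simp: b bform_e_right)
    finally show "(transpose_mat ?A * ?D) $$ (i, j) = (1\<^sub>m n :: complex mat) $$ (i, j)" .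
  qed simp_all
  finally show ?thesis by (simp add: fin_det_eq[OF fx])
qed

section \<open>The groups \<open>G\<close> and \<open>G0\<close>\<close>

lemma G_fixes_beyond:
  assumes "g \<in> G"
  obtains n where "fixes_beyond n g"
proof -
  have fin: "finite {i. g (e i) \<noteq> e i}" using assms by (simp add: G_def)
  \<comment> \<open>The inserted 0 gives \<open>Max\<close> a value when \<open>g\<close> fixes
    every basis vector.\<close>
  define n where "n = nat (Max (insert 0 (abs ` {i. g (e i) \<noteq> e i})))"
  have "fixes_beyond n g"
    unfolding fixes_beyond_def
  proof (intro allI impI, rule ccontr)
    fix i assume i: "\<bar>i\<bar> > int n" "g (e i) \<noteq> e i"
    then have "\<bar>i\<bar> \<le> Max (insert 0 (abs ` {i. g (e i) \<noteq> e i}))"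
      using fin by (intro Max_ge) auto
    with i show False unfolding n_def by linarith
  qed
  then show ?thesis using that by blast
qed

lemma G_D:
  assumes "g \<in> G"
  shows "lin g" "bij g" "bform (g x) (g y) = bform x y" "fin_det g = 1"
  using assms by (auto simp: G_def)

lemma G_I:
  assumes "lin g" "bij g" "fixes_beyond n g" "fin_det g = 1" "\<And>x y. bform (g x) (g y) = bform x y"
  shows "g \<in> G"
proof -
  have "{i. g (e i) \<noteq> e i} \<subseteq> {- int n..int n}"
    using assms(3) by (force simp: fixes_beyond_def abs_less_iff not_less)
  then have "finite {i. g (e i) \<noteq> e i}" by (rule finite_subset) simp
  with assms show ?thesis by (simp add: G_def)
qed

lemma G_comp:
  assumes "g \<in> G" "k \<in> G"
  shows "g \<circ> k \<in> G"
proof -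
  obtain m m' where m: "fixes_beyond m g" "fixes_beyond m' k"
    using assms G_fixes_beyond by metis
  define n where "n = max m m'"
  have n: "fixes_beyond n g" "fixes_beyond n k"
    using m by (auto intro: fixes_beyond_mono simp: n_def)
  show ?thesis
  proof (rule G_I)
    show "lin (g \<circ> k)" using G_D(1)[OF assms(1)] G_D(1)[OF assms(2)] by (simp add: linear_iff)
    show "bij (g \<circ> k)" using G_D(2)[OF assms(1)] G_D(2)[OF assms(2)] by (simp add: bij_comp)
    show "fixes_beyond n (g \<circ> k)" using n by (simp add: fixes_beyond_def)
    show "fin_det (g \<circ> k) = 1"
      using fin_det_comp[OF G_D(1)[OF assms(1)] n G_D(3)[OF assms(2)]] assms by (simp add: G_D)
    show "bform ((g \<circ> k) x) ((g \<circ> k) y) = bform x y" for x y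
      using assms by (simp add: G_D)
  qed
qed

lemma G0_comp: "g \<in> G0 \<Longrightarrow> k \<in> G0 \<Longrightarrow> g \<circ> k \<in> G0"
  by (simp add: G0_def G_comp)

subsection \<open>Graphs of maps from the negative to the positive space\<close>

text \<open>The unipotent map 1 + Z on all of V, with Z extended by 0 to V_+. The inner
  \<open>pi_minus\<close> makes this extension, since members of \<open>lin_maps\<close> are
  \<open>undefined\<close> off \<open>Vminus\<close>.\<close>

definition shear :: "(V \<Rightarrow> V) \<Rightarrow> V \<Rightarrow> V" where
  "shear Z x = x + Z (pi_minus x)"

definition graph :: "(V \<Rightarrow> V) \<Rightarrow> V set" where
  "graph Z = shear Z ` Vminus"

lemma lin_maps_D:
  assumes "Z \<in> lin_maps Vminus Vplus"
  shows "x \<in> Vminus \<Longrightarrow> Z x \<in> Vplus" "x \<notin> Vminus \<Longrightarrow> Z x = undefined"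
    "x \<in> Vminus \<Longrightarrow> y \<in> Vminus \<Longrightarrow> Z (x + y) = Z x + Z y"
    "x \<in> Vminus \<Longrightarrow> Z (scaleV c x) = scaleV c (Z x)"
  using assms by (auto simp: lin_maps_def)

lemma skew_maps_D:
  assumes "Z \<in> skew_maps"
  shows "Z \<in> lin_maps Vminus Vplus" "finitary_mat (matrix_of Z)" "antisymmetric_mat (matrix_of Z)"
  using assms by (auto simp: skew_maps_def)

lemma lin_extend:
  assumes Z: "Z \<in> lin_maps Vminus Vplus"
  shows "lin (\<lambda>x. Z (pi_minus x))"
  by (simp add: linear_iff pi_add pi_scale lin_maps_D[OF Z])

lemma lin_maps_zero:
  assumes "Z \<in> lin_maps Vminus Vplus"
  shows "Z 0 = 0"
  using lin_zero[OF lin_extend[OF assms]] VS.subspace_0[OF subspace_Vminus] by (simp add: pi_on_Vminus)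

lemma lin_shear:
  assumes "Z \<in> lin_maps Vminus Vplus"
  shows "lin (shear Z)"
  using lin_extend[OF assms] by (simp add: linear_iff shear_def VS.scale_right_distrib algebra_simps)

lemma shear_Vminus: "x \<in> Vminus \<Longrightarrow> shear Z x = x + Z x"
  by (simp add: shear_def pi_on_Vminus)

lemma pi_shear:
  assumes "Z \<in> lin_maps Vminus Vplus"
  shows "pi_minus (shear Z x) = pi_minus x" "pi_plus (shear Z x) = pi_plus x + Z (pi_minus x)"
  using lin_maps_D(1)[OF assms, of "pi_minus x"]
  by (simp_all add: shear_def pi_add pi_on_Vplus pi_on_Vminus)

lemma graph_iff:
  assumes Z: "Z \<in> lin_maps Vminus Vplus"
  shows "x \<in> graph Z \<longleftrightarrow> pi_plus x = Z (pi_minus x)"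
proof
  assume "x \<in> graph Z"
  then show "pi_plus x = Z (pi_minus x)"
    by (auto simp: graph_def pi_shear[OF Z] pi_on_Vminus)
next
  assume "pi_plus x = Z (pi_minus x)"
  then have "x = shear Z (pi_minus x)"
    using pi_decomp[of x] by (simp add: shear_Vminus)
  then show "x \<in> graph Z" unfolding graph_def by (rule image_eqI) simp
qed

lemma subspace_graph:
  assumes Z: "Z \<in> lin_maps Vminus Vplus"
  shows "VS.subspace (graph Z)"
proof -
  have "pi_minus 0 = 0" "pi_plus 0 = 0"
    using VS.subspace_0[OF subspace_Vminus] by (simp_all add: pi_on_Vminus)
  then show ?thesis
    by (simp add: VS.subspace_def graph_iff[OF Z] pi_add pi_scale lin_maps_D[OF Z] lin_maps_zero[OF Z])
qed

lemma bij_shear_graph: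
  assumes Z: "Z \<in> lin_maps Vminus Vplus"
  shows "bij_betw (shear Z) Vminus (graph Z)"
  unfolding graph_def bij_betw_def
  by (rule conjI[OF inj_onI refl]) (metis pi_shear(1)[OF Z] pi_on_Vminus(1))

lemma bij_pi_minus_graph:
  assumes Z: "Z \<in> lin_maps Vminus Vplus"
  shows "bij_betw pi_minus (graph Z) Vminus"
  by (rule bij_betw_byWitness[where f' = "shear Z"])
    (auto simp: graph_def pi_shear[OF Z] pi_on_Vminus)

text \<open>A point of the graph is determined by its V_- component, so the description operator
  yields \<open>Z y\<close>. Off \<open>Vminus\<close> both sides are \<open>undefined\<close>,
  which makes them equal as functions.\<close>

lemma realization_graph:
  assumes Z: "Z \<in> lin_maps Vminus Vplus"
  shows "realization (F0, graph Z, F2) = Z"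
proof
  fix y
  show "realization (F0, graph Z, F2) y = Z y"
  proof (cases "y \<in> Vminus")
    case True
    have "(THE w. \<exists>x\<in>graph Z. pi_minus x = y \<and> pi_plus x = w) = Z y"
    proof (rule the_equality)
      show "\<exists>x\<in>graph Z. pi_minus x = y \<and> pi_plus x = Z y"
        by (rule bexI[of _ "shear Z y"]) (use True in \<open>auto simp: graph_def pi_shear[OF Z] pi_on_Vminus\<close>)
    qed (auto simp: graph_iff[OF Z])
    then show ?thesis by (simp add: realization_def True)
  qed (simp add: realization_def lin_maps_D[OF Z])
qed

text \<open>The inverse s of the projection is linear because s y + s y' lies in F and projects to y
  + y'; the map sought is the V_+ component of s.\<close>

lemma ex_graph:
  assumes F: "VS.subspace F" and bij: "bij_betw pi_minus F Vminus"
  obtains Z where "Z \<in> lin_maps Vminus Vplus" "F = graph Z"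
proof
  define s where "s = inv_into F pi_minus"
  have s: "s y \<in> F" "pi_minus (s y) = y" if "y \<in> Vminus" for y
    using bij that by (auto simp: s_def bij_betw_def inv_into_into f_inv_into_f)
  have s_pi: "s (pi_minus x) = x" if "x \<in> F" for x
    using bij that by (simp add: s_def bij_betw_def)
  define Z where "Z = (\<lambda>y\<in>Vminus. pi_plus (s y))"
  have add: "s (y + y') = s y + s y'" if "y \<in> Vminus" "y' \<in> Vminus" for y y'
    using s_pi[of "s y + s y'"] s that VS.subspace_add[OF F] by (simp add: pi_add)
  have scale: "s (scaleV c y) = scaleV c (s y)" if "y \<in> Vminus" for c y
    using s_pi[of "scaleV c (s y)"] s that VS.subspace_scale[OF F] by (simp add: pi_scale)
  show Z: "Z \<in> lin_maps Vminus Vplus"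
    by (auto simp: lin_maps_def Z_def add scale pi_add pi_scale VS.subspace_add[OF subspace_Vminus]
        VS.subspace_scale[OF subspace_Vminus])
  show "F = graph Z"
  proof (intro Set.set_eqI iffI)
    fix x assume "x \<in> F"
    then show "x \<in> graph Z" unfolding graph_iff[OF Z] by (simp add: Z_def s_pi)
  next
    fix x assume "x \<in> graph Z"
    then have "pi_plus x = pi_plus (s (pi_minus x))" unfolding graph_iff[OF Z] by (simp add: Z_def)
    then have "x = s (pi_minus x)"
      using pi_decomp[of x] pi_decomp[of "s (pi_minus x)"] s(2)[of "pi_minus x"] by simp
    then show "x \<in> F" using s(1)[of "pi_minus x"] by simp
  qed
qed

section \<open>Matrix entries and the levels of finitary maps\<close>

lemma Vminus_supp_pos: "x \<in> Vminus \<Longrightarrow> i \<in> supp x \<Longrightarrow> i > 0"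
  by (auto simp: Vminus_iff in_supp) (metis coord_0_index less_linear)

lemma Vplus_supp_neg: "x \<in> Vplus \<Longrightarrow> i \<in> supp x \<Longrightarrow> i < 0"
  by (auto simp: Vplus_iff in_supp) (metis coord_0_index less_linear)

lemma coord_apply:
  assumes Z: "Z \<in> lin_maps Vminus Vplus" and x: "x \<in> Vminus" and j: "j > 0"
  shows "coord (Z x) (- j) = (\<Sum>i\<in>supp x. matrix_of Z j i * coord x i)"
proof -
  have "coord (Z x) (- j) = (\<Sum>i\<in>supp x. coord x i * coord (Z (pi_minus (e i))) (- j))"
    using lin_expand[OF lin_extend[OF Z], of x] x by (simp add: pi_on_Vminus coord_sum)
  also have "\<dots> = (\<Sum>i\<in>supp x. matrix_of Z j i * coord x i)"
    using Vminus_supp_pos[OF x] j by (intro sum.cong) (simp_all add: matrix_of_def e_Vminus pi_on_Vminus)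
  finally show ?thesis .
qed

lemma skew_level_ex:
  assumes "Z \<in> skew_maps"
  obtains n where "Z \<in> skew_level n"
proof -
  let ?S = "fst ` {(j, i). matrix_of Z j i \<noteq> 0} \<union> snd ` {(j, i). matrix_of Z j i \<noteq> 0}"
  have fin: "finite ?S" using skew_maps_D(2)[OF assms] by (simp add: finitary_mat_def)
  define n where "n = nat (Max (insert 0 ?S))"
  have "j \<le> int n" if "j \<in> ?S" for j
  proof -
    have "j \<le> Max (insert 0 ?S)" using fin that by (intro Max_ge) auto
    then show ?thesis by (simp add: n_def)
  qed
  moreover have "j \<in> ?S \<and> i \<in> ?S" if "matrix_of Z j i \<noteq> 0" for j i
    using that by force
  ultimately have "Z \<in> skew_level n" using assms by (simp add: skew_level_def)
  then show ?thesis using that by blast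
qed

lemma skew_level_e:
  assumes "Z \<in> skew_level n"
  shows "i > int n \<Longrightarrow> Z (e i) = 0" "i > 0 \<Longrightarrow> supp (Z (e i)) \<subseteq> {- int n..- 1}"
proof -
  have Z: "Z \<in> lin_maps Vminus Vplus"
    and M: "\<And>j i. matrix_of Z j i \<noteq> 0 \<Longrightarrow> j \<le> int n \<and> i \<le> int n"
    using assms by (auto simp: skew_level_def skew_maps_def)
  have c: "coord (Z (e i)) k = (if k < 0 then matrix_of Z (- k) i else 0)" if "i > 0" for i k
    using lin_maps_D(1)[OF Z e_Vminus[OF that]] that
    by (auto simp: Vplus_iff matrix_of_def) (metis coord_0_index less_linear)
  show "Z (e i) = 0" if "i > int n"
    by (rule V_eqI) (use M[of _ i] that c[of i] in force)
  show "supp (Z (e i)) \<subseteq> {- int n..- 1}" if "i > 0"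
    using M[of _ i] c[OF that] by (force simp: in_supp split: if_splits)
qed

lemma fixes_beyond_shear:
  assumes "Z \<in> skew_level n"
  shows "fixes_beyond n (shear Z)"
  unfolding fixes_beyond_def
proof (intro allI impI)
  fix i :: int assume i: "\<bar>i\<bar> > int n"
  have Z: "Z \<in> lin_maps Vminus Vplus" using assms by (auto simp: skew_level_def skew_maps_def)
  show "shear Z (e i) = e i"
  proof (cases "i > 0")
    case True
    then show ?thesis using i skew_level_e(1)[OF assms] by (simp add: shear_Vminus e_Vminus)
  next
    case False
    then have "pi_minus (e i) = 0" by (intro pi_on_Vplus) (auto simp: Vplus_iff)
    then show ?thesis by (simp add: shear_def lin_maps_zero[OF Z])
  qed
qed

section \<open>The two forms on a graph\<close>

lemma bform_Vplus: "x \<in> Vplus \<Longrightarrow> y \<in> Vplus \<Longrightarrow> bform x y = 0"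
  by (auto simp: bform_def Vplus_iff intro!: sum.neutral) (metis coord_0_index less_linear neg_less_0_iff_less)

lemma bform_Vminus: "x \<in> Vminus \<Longrightarrow> y \<in> Vminus \<Longrightarrow> bform x y = 0"
  by (auto simp: bform_def Vminus_iff intro!: sum.neutral) (metis coord_0_index less_linear neg_less_0_iff_less)

lemma hform_Vplus_Vminus: "x \<in> Vplus \<Longrightarrow> y \<in> Vminus \<Longrightarrow> hform x y = 0"
  by (auto simp: hform_def Vplus_iff Vminus_iff intro!: sum.neutral) (metis coord_0_index less_linear)

text \<open>As b vanishes on pairs from V_+, only the two mixed terms could change its value. On e_i
  and e_j with positive indices they add up to z_{j,i} + z_{i,j}, which antisymmetry makes
  0.\<close>

lemma bform_shear:
  assumes Z: "Z \<in> skew_maps"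
  shows "bform (shear Z x) (shear Z y) = bform x y"
proof (rule lin_bform[OF lin_shear[OF skew_maps_D(1)[OF Z]]])
  fix i j :: int assume ij: "i \<noteq> 0" "j \<noteq> 0"
  have L: "Z \<in> lin_maps Vminus Vplus" by (rule skew_maps_D(1)[OF Z])
  have VP: "Z (pi_minus (e k)) \<in> Vplus" for k by (simp add: lin_maps_D(1)[OF L])
  have c: "coord (Z (pi_minus (e k))) (- l) = (if k > 0 \<and> l > 0 then matrix_of Z l k else 0)"
    if "k \<noteq> 0" "l \<noteq> 0" for k l
  proof (cases "k > 0")
    case True
    then show ?thesis using VP[of k] that
      by (auto simp: matrix_of_def pi_on_Vminus e_Vminus Vplus_iff)
  next
    case False
    then have "pi_minus (e k) = 0" using that by (intro pi_on_Vplus) (auto simp: Vplus_iff)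
    then show ?thesis using False by (simp add: lin_maps_zero[OF L])
  qed
  have "matrix_of Z l k + matrix_of Z k l = 0" if "k > 0" "l > 0" for k l
    using skew_maps_D(3)[OF Z] that unfolding antisymmetric_mat_def by (metis add.left_inverse)
  then show "bform (shear Z (e i)) (shear Z (e j)) = bform (e i) (e j)"
    using ij VP[of i] VP[of j]
    by (simp add: shear_def bform_add_left bform_add_right bform_Vplus bform_e_left
        bform_e_right c del: coord_e)
qed

text \<open>With V_+ listed first, 1 + Z is block upper triangular with identity matrices on the
  diagonal.\<close>

lemma fin_det_shear:
  assumes "Z \<in> skew_level n"
  shows "fin_det (shear Z) = 1"
proof -
  have Z: "Z \<in> lin_maps Vminus Vplus" using assms by (auto simp: skew_level_def skew_maps_def)
  let ?B = "mat n n (\<lambda>(r, c). coord (shear Z (e (int c + 1))) (- int r - 1))"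
  have plus: "shear Z (e (- int c - 1)) = e (- int c - 1)" for c
  proof -
    have "pi_minus (e (- int c - 1)) = 0" by (intro pi_on_Vplus) (auto simp: Vplus_iff)
    then show ?thesis by (simp add: shear_def lin_maps_zero[OF Z])
  qed
  have minus: "coord (shear Z (e (int c + 1))) (int r + 1) = (if r = c then 1 else 0)" for c r
    using lin_maps_D(1)[OF Z e_Vminus, of "int c + 1"] by (auto simp: shear_Vminus e_Vminus Vplus_iff)
  have "truncation n (shear Z) = four_block_mat (1\<^sub>m n) ?B (0\<^sub>m n n) (1\<^sub>m n)"
    unfolding truncation_four_block[of n "shear Z"] plus minus
    by (intro arg_cong4[where f = four_block_mat] eq_matI) auto
  then have "Determinant.det (truncation n (shear Z)) = 1"
    using det_four_block_mat_lower_left_zero[of "1\<^sub>m n" n ?B n "0\<^sub>m n n" "1\<^sub>m n"] by simp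
  then show ?thesis by (simp add: fin_det_eq[OF fixes_beyond_shear[OF assms]])
qed

lemma hform_self_Vminus:
  assumes "x \<in> Vminus" "finite S" "supp x \<subseteq> S"
  shows "hform x x = - complex_of_real (\<Sum>i\<in>S. (cmod (coord x i))\<^sup>2)"
proof -
  have "hform x x = (\<Sum>i\<in>S. - complex_of_real ((cmod (coord x i))\<^sup>2))"
    unfolding hform_sum[OF assms(2,3)]
  proof (rule sum.cong[OF refl])
    fix i
    show "(if i < 0 then 1 else - 1) * coord x i * cnj (coord x i) = - complex_of_real ((cmod (coord x i))\<^sup>2)"
      using assms(1) by (cases "i < 0") (auto simp: Vminus_iff complex_norm_square[symmetric])
  qed
  then show ?thesis by (simp add: sum_negf)
qed

lemma hform_self_Vplus:
  assumes "x \<in> Vplus" "finite S" "supp x \<subseteq> S"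
  shows "hform x x = complex_of_real (\<Sum>i\<in>S. (cmod (coord x i))\<^sup>2)"
proof -
  have "hform x x = (\<Sum>i\<in>S. complex_of_real ((cmod (coord x i))\<^sup>2))"
    unfolding hform_sum[OF assms(2,3)]
  proof (rule sum.cong[OF refl])
    fix i
    show "(if i < 0 then 1 else - 1) * coord x i * cnj (coord x i) = complex_of_real ((cmod (coord x i))\<^sup>2)"
      using assms(1) by (cases "i < 0"; cases "i = 0") (auto simp: Vplus_iff complex_norm_square[symmetric])
  qed
  then show ?thesis by simp
qed

lemma Im_hform_self: "Im (hform x x) = 0"
  using hform_commute[of x x] by (metis complex_cnj_cancel_iff Reals_cnj_iff complex_is_Real_iff)

lemma hform_shear:
  assumes Z: "Z \<in> lin_maps Vminus Vplus" and x: "x \<in> Vminus"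
  shows "hform (shear Z x) (shear Z x) = hform x x + hform (Z x) (Z x)"
proof -
  have "hform (Z x) x = 0" using hform_Vplus_Vminus lin_maps_D(1)[OF Z x] x by blast
  then have "hform x (Z x) = 0" using hform_commute[of x "Z x"] by simp
  with \<open>hform (Z x) x = 0\<close> show ?thesis
    by (simp add: shear_Vminus[OF x] hform_add_left hform_add_right)
qed

text \<open>This is x^*(I - Z^*Z)x = |x|^2 - |Zx|^2, where the squared norms are -h on V_- and h on
  V_+. It turns the matrix condition into a condition on h along the graph.\<close>

lemma quadratic_form:
  assumes Z: "Z \<in> lin_maps Vminus Vplus" and fin: "finitary_mat (matrix_of Z)" and x: "x \<in> Vminus"
  shows "(\<Sum>k\<in>supp x. \<Sum>l\<in>supp x. cnj (coord x k) *
      (one_imat k l - imat_mult (conj_transpose (matrix_of Z)) (matrix_of Z) k l) * coord x l) =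
      - hform (shear Z x) (shear Z x)" (is "?q = _")
proof -
  let ?M = "matrix_of Z"
  \<comment> \<open>The finitely many nonzero rows: summing over \<open>T\<close> makes the index
    set in \<open>imat_mult\<close> independent of the column.\<close>
  define T where "T = fst ` {(j, i). ?M j i \<noteq> 0}"
  have T: "finite T" "\<And>j i. ?M j i \<noteq> 0 \<Longrightarrow> j \<in> T"
    using fin by (force simp: T_def finitary_mat_def)+
  have Tpos: "j > 0" if "j \<in> T" for j
    using that by (auto simp: T_def matrix_of_def split: if_splits)
  have mult: "imat_mult (conj_transpose ?M) ?M k l = (\<Sum>j\<in>T. cnj (?M j k) * ?M j l)" for k l
    unfolding imat_mult_def conj_transpose_def using T by (intro sum.mono_neutral_left) auto
  have "(\<Sum>k\<in>supp x. \<Sum>l\<in>supp x. cnj (coord x k) * one_imat k l * coord x l) =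
      (\<Sum>k\<in>supp x. \<Sum>l\<in>supp x. if k = l then cnj (coord x k) * coord x k else 0)"
    using Vminus_supp_pos[OF x] by (intro sum.cong) (auto simp: one_imat_def)
  also have "\<dots> = (\<Sum>k\<in>supp x. complex_of_real ((cmod (coord x k))\<^sup>2))"
    by (simp add: complex_norm_square[symmetric] mult.commute)
  also have "\<dots> = - hform x x"
    by (simp add: hform_self_Vminus[OF x, of "supp x"])
  finally have one: "(\<Sum>k\<in>supp x. \<Sum>l\<in>supp x. cnj (coord x k) * one_imat k l * coord x l) = - hform x x" .
  have "(\<Sum>k\<in>supp x. \<Sum>l\<in>supp x. cnj (coord x k) * (\<Sum>j\<in>T. cnj (?M j k) * ?M j l) * coord x l) =
      (\<Sum>k\<in>supp x. \<Sum>l\<in>supp x. \<Sum>j\<in>T. cnj (?M j k * coord x k) * (?M j l * coord x l))"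
    by (simp add: sum_distrib_left sum_distrib_right algebra_simps)
  also have "\<dots> = (\<Sum>k\<in>supp x. \<Sum>j\<in>T. \<Sum>l\<in>supp x. cnj (?M j k * coord x k) * (?M j l * coord x l))"
    by (rule sum.cong[OF refl], rule sum.swap)
  also have "\<dots> = (\<Sum>j\<in>T. \<Sum>k\<in>supp x. \<Sum>l\<in>supp x. cnj (?M j k * coord x k) * (?M j l * coord x l))"
    by (rule sum.swap)
  also have "\<dots> = (\<Sum>j\<in>T. cnj (coord (Z x) (- j)) * coord (Z x) (- j))"
    by (intro sum.cong refl)
      (simp only: coord_apply[OF Z x Tpos] cnj_sum sum_product)
  also have "\<dots> = (\<Sum>i\<in>uminus ` T. coord (Z x) i * cnj (coord (Z x) i))"
    by (subst sum.reindex) (auto simp: inj_on_def mult.commute)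
  also have "\<dots> = hform (Z x) (Z x)"
  proof -
    have "supp (Z x) \<subseteq> uminus ` T"
    proof
      fix i assume i: "i \<in> supp (Z x)"
      then have "i < 0" using Vplus_supp_neg lin_maps_D(1)[OF Z x] by blast
      with i have "(\<Sum>k\<in>supp x. ?M (- i) k * coord x k) \<noteq> 0"
        using coord_apply[OF Z x, of "- i"] by (simp add: in_supp)
      then obtain k where "?M (- i) k \<noteq> 0" by (metis (no_types, lifting) mult_zero_left sum.neutral)
      then have "- i \<in> T" by (rule T(2))
      then show "i \<in> uminus ` T" by (rule image_eqI[rotated]) simp
    qed
    then show ?thesis using T(1) Tpos
      by (subst hform_sum[of "uminus ` T"]) (auto intro!: sum.cong)
  qed
  finally have two: "(\<Sum>k\<in>supp x. \<Sum>l\<in>supp x. cnj (coord x k) *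
      (\<Sum>j\<in>T. cnj (?M j k) * ?M j l) * coord x l) = hform (Z x) (Z x)" .
  have "?q = (\<Sum>k\<in>supp x. \<Sum>l\<in>supp x. cnj (coord x k) * one_imat k l * coord x l) -
     (\<Sum>k\<in>supp x. \<Sum>l\<in>supp x. cnj (coord x k) * (\<Sum>j\<in>T. cnj (?M j k) * ?M j l) * coord x l)"
    unfolding mult by (simp only: right_diff_distrib left_diff_distrib sum_subtractf)
  then show ?thesis by (simp add: one two hform_shear[OF Z x])
qed

text \<open>Since h is hermitian, the values of the quadratic form are real, and positive
  definiteness reduces to a sign.\<close>

lemma Z_domain_iff:
  assumes Z: "Z \<in> skew_maps"
  shows "Z \<in> Z_domain \<longleftrightarrow> (\<forall>x\<in>Vminus. x \<noteq> 0 \<longrightarrow> Re (hform (shear Z x) (shear Z x)) < 0)"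
proof -
  let ?q = "\<lambda>x. \<Sum>k\<in>supp x. \<Sum>l\<in>supp x. cnj (coord x k) *
      (one_imat k l - imat_mult (conj_transpose (matrix_of Z)) (matrix_of Z) k l) * coord x l"
  have "Im (?q x) = 0 \<and> Re (?q x) > 0 \<longleftrightarrow> Re (hform (shear Z x) (shear Z x)) < 0" if "x \<in> Vminus" for x
    unfolding quadratic_form[OF skew_maps_D(1,2)[OF Z] that] by (simp add: Im_hform_self)
  then show ?thesis
    unfolding Z_domain_def positive_definite_mat_def Let_def using Z by blast
qed

lemma shear_eq_0:
  assumes "Z \<in> lin_maps Vminus Vplus" "x \<in> Vminus"
  shows "shear Z x = 0 \<longleftrightarrow> x = 0"
  by (metis assms lin_shear lin_zero pi_on_Vminus(1) pi_shear(1) VS.subspace_0[OF subspace_Vminus])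

text \<open>Finitariness cannot be read off from isotropy and sign of the graph, so it enters as a
  hypothesis; the other two conditions on Z match these two properties.\<close>

lemma Z_domain_graph:
  assumes Z: "Z \<in> lin_maps Vminus Vplus" and fin: "finitary_mat (matrix_of Z)"
  shows "Z \<in> Z_domain \<longleftrightarrow> negative_isotropic (graph Z)"
proof
  assume "Z \<in> Z_domain"
  then have S: "Z \<in> skew_maps" by (simp add: Z_domain_def)
  show "negative_isotropic (graph Z)"
    unfolding negative_isotropic_def
  proof (intro conjI)
    show "\<forall>x\<in>graph Z. x \<noteq> 0 \<longrightarrow> Re (hform x x) < 0"
      using \<open>Z \<in> Z_domain\<close> Z_domain_iff[OF S] shear_eq_0[OF Z] by (auto simp: graph_def)
    show "\<forall>x\<in>graph Z. \<forall>y\<in>graph Z. bform x y = 0"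
      by (auto simp: graph_def bform_shear[OF S] bform_Vminus)
  qed (rule subspace_graph[OF Z])
next
  assume neg: "negative_isotropic (graph Z)"
  have "matrix_of Z j i = - matrix_of Z i j" if ij: "i > 0" "j > 0" for i j
  proof -
    have "shear Z (e i) \<in> graph Z" "shear Z (e j) \<in> graph Z"
      using ij by (auto simp: graph_def e_Vminus)
    then have "bform (shear Z (e i)) (shear Z (e j)) = 0"
      using neg by (simp add: negative_isotropic_def)
    moreover have "Z (e i) \<in> Vplus" "Z (e j) \<in> Vplus"
      using ij by (simp_all add: lin_maps_D(1)[OF Z] e_Vminus)
    \<comment> \<open>Expanding b on the points of the graph over \<open>e i\<close> and
      \<open>e j\<close> leaves exactly the mixed terms, which are the entries (j, i) and (i,
      j).\<close>
    ultimately have "coord (Z (e i)) (- j) + coord (Z (e j)) (- i) = 0"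
      using ij by (simp add: shear_Vminus e_Vminus bform_add_left bform_add_right bform_Vplus
          bform_e_left bform_e_right del: coord_e) (simp add: add.commute)
    then show ?thesis using ij by (simp add: matrix_of_def add_eq_0_iff)
  qed
  then have "antisymmetric_mat (matrix_of Z)" unfolding antisymmetric_mat_def by blast
  then have S: "Z \<in> skew_maps" using Z fin by (simp add: skew_maps_def)
  show "Z \<in> Z_domain"
    unfolding Z_domain_iff[OF S]
    using neg shear_eq_0[OF Z] by (auto simp: negative_isotropic_def graph_def)
qed

text \<open>V_- is its own b-orthogonal complement, because pairing with e(-i) for i < 0 reads off
  the V_+ coordinates. The bijective isometry \<open>g\<close> carries this over to g V_-.\<close>

lemma isotropic_Vminus_maximal:
  assumes g: "g \<in> G" and W: "\<And>x y. x \<in> W \<Longrightarrow> y \<in> W \<Longrightarrow> bform x y = 0" "g ` Vminus \<subseteq> W"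
  shows "W = g ` Vminus"
proof
  show "W \<subseteq> g ` Vminus"
  proof
    fix x assume x: "x \<in> W"
    obtain y where y: "x = g y" using G_D(2)[OF g] by (metis bij_pointE)
    have "coord y i = 0" if "i < 0" for i
    proof -
      have "g (e (- i)) \<in> W" using W(2) e_Vminus[of "- i"] that by auto
      then have "bform (g y) (g (e (- i))) = 0" using W(1) x y by blast
      then show ?thesis by (simp add: G_D(3)[OF g] bform_e_right)
    qed
    then show "x \<in> g ` Vminus" using y by (simp add: Vminus_iff)
  qed
qed (rule W(2))

lemma negative_isotropic_Vminus: "negative_isotropic Vminus"
  unfolding negative_isotropic_def
proof (intro conjI ballI impI)
  fix x assume x: "x \<in> Vminus" "x \<noteq> 0"
  then obtain i where "i \<in> supp x" by (metis V_eqI coord_simps(1) in_supp)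
  then have "(\<Sum>i\<in>supp x. (cmod (coord x i))\<^sup>2) > 0"
    by (intro sum_pos2[of _ i]) (auto simp: in_supp)
  then show "Re (hform x x) < 0" by (simp add: hform_self_Vminus[OF x(1), of "supp x"])
qed (auto simp: subspace_Vminus bform_Vminus)

lemma subspace_image_lin: "lin g \<Longrightarrow> VS.subspace W \<Longrightarrow> VS.subspace (g ` W)"
  unfolding VS.subspace_def
  by (auto simp: image_iff) (metis lin_zero lin_add lin_scale)+

lemma negative_isotropic_G0:
  assumes g: "g \<in> G0" and W: "negative_isotropic W"
  shows "negative_isotropic (g ` W)"
proof -
  have gG: "g \<in> G" and h: "\<And>x y. hform (g x) (g y) = hform x y" using g by (auto simp: G0_def)
  show ?thesis
    using W subspace_image_lin[OF G_D(1)[OF gG]] lin_zero[OF G_D(1)[OF gG]]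
    by (auto simp: negative_isotropic_def h G_D(3)[OF gG])
qed

text \<open>Taking \<open>g\<close> from \<open>G\<close> lets the lemma serve both for
  \<open>D0\<close> and for flags known only to lie in the flag manifold and to have a negative
  middle space.\<close>

lemma graph_of_negative:
  assumes g: "g \<in> G" and neg: "negative_isotropic (g ` Vminus)"
  obtains Z where "Z \<in> Z_domain" "g ` Vminus = graph Z"
proof -
  note lg = G_D(1)[OF g]
  obtain n where fx: "fixes_beyond n g" using G_fixes_beyond[OF g] .
  \<comment> \<open>An endomorphism of all of V that is pi_- o g on V_- and the identity on V_+. It
    is injective or onto exactly when pi_- o g is so on V_-, and it has the shape required by
    \<open>lin_inj_surj\<close>.\<close>
  define T where "T x = pi_minus (g (pi_minus x)) + pi_plus x" for x
  \<comment> \<open>The kernel of \<open>pi_minus\<close> is V_+, where h is nonnegative.\<close>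
  have no_kernel: "w = 0" if "w \<in> g ` Vminus" "pi_minus w = 0" for w
  proof (rule ccontr)
    assume "w \<noteq> 0"
    have "w \<in> Vplus" using pi_decomp[of w] that(2) pi_plus_in[of w] by simp
    then have "Re (hform w w) \<ge> 0"
      by (simp add: hform_self_Vplus[of w "supp w"] sum_nonneg)
    with neg that(1) \<open>w \<noteq> 0\<close> show False by (force simp: negative_isotropic_def)
  qed
  have linT: "lin T"
    by (simp add: linear_iff T_def pi_add pi_scale lin_add[OF lg] lin_scale[OF lg] VS.scale_right_distrib)
  have T_pi: "pi_minus (T x) = pi_minus (g (pi_minus x))" "pi_plus (T x) = pi_plus x" for x
    by (simp_all add: T_def pi_add pi_on_Vminus pi_on_Vplus)
  have "x = 0" if "T x = 0" for x
  proof -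
    have zero: "pi_minus (g (pi_minus x)) = 0" "pi_plus x = 0"
      using T_pi[of x] that by (simp_all add: pi_on_Vminus VS.subspace_0[OF subspace_Vminus])
    have "g (pi_minus x) = g 0"
      unfolding lin_zero[OF lg] using zero(1) by (rule no_kernel[OF imageI[OF pi_minus_in]])
    then have "pi_minus x = 0" by (rule injD[OF bij_is_inj[OF G_D(2)[OF g]]])
    with zero(2) show "x = 0" using pi_decomp[of x] by simp
  qed
  then have injT: "inj T"
    by (metis injI lin_diff[OF linT] eq_iff_diff_eq_0)
  have pi_e: "pi_minus (e i) = (if i > 0 then e i else 0)" "pi_plus (e i) = (if i > 0 then 0 else e i)" for i
    by (rule V_eqI; auto simp: coord_pi_minus coord_pi_plus)+
  have g0: "g 0 = 0" by (rule lin_zero[OF lg])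
  have pm0: "pi_minus 0 = 0" by (simp add: pi_on_Vminus VS.subspace_0[OF subspace_Vminus])
  have Te: "T (e i) = (if i > 0 then pi_minus (g (e i)) else e i)" for i
    by (simp add: T_def pi_e g0 pm0)
  have "surj T"
  proof (rule lin_inj_surj[OF linT injT])
    show "T (e i) = e i" if "\<bar>i\<bar> > int n" for i
      using that fx by (auto simp: Te fixes_beyond_def pi_e)
    show "supp (T (e i)) \<subseteq> {- int n..int n}" if "\<bar>i\<bar> \<le> int n" for i
    proof (cases "i > 0")
      case True
      have "supp (pi_minus (g (e i))) \<subseteq> supp (g (e i))" by (auto simp: in_supp coord_pi_minus split: if_splits)
      also have "\<dots> \<subseteq> {- int n..int n}" by (rule supp_isometry_e[OF fx G_D(3)[OF g] that])
      finally show ?thesis using True by (simp add: Te)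
    next
      case False
      then show ?thesis using that by (auto simp: Te in_supp split: if_splits)
    qed
  qed
  have sub: "VS.subspace (g ` Vminus)" using neg by (simp add: negative_isotropic_def)
  have "bij_betw pi_minus (g ` Vminus) Vminus"
    unfolding bij_betw_def
  proof
    show "inj_on pi_minus (g ` Vminus)"
    proof (rule inj_onI)
      fix x y assume xy: "x \<in> g ` Vminus" "y \<in> g ` Vminus" "pi_minus x = pi_minus y"
      have "pi_minus (x - y) = 0" by (rule V_eqI) (use xy(3) in \<open>metis coord_pi_minus coord_simps(1,4) diff_self\<close>)
      then have "x - y = 0" using VS.subspace_diff[OF sub xy(1,2)] by (rule no_kernel[rotated])
      then show "x = y" by simp
    qed
    show "pi_minus ` g ` Vminus = Vminus"
    proof
      show "Vminus \<subseteq> pi_minus ` g ` Vminus"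
      proof
        fix y assume y: "y \<in> Vminus"
        obtain x where "T x = y" using \<open>surj T\<close> by (metis surjD)
        then have "pi_minus (g (pi_minus x)) = y" using T_pi(1)[of x] pi_on_Vminus(1)[OF y] by simp
        then show "y \<in> pi_minus ` g ` Vminus" by force
      qed
    qed auto
  qed
  then obtain Z where Z: "Z \<in> lin_maps Vminus Vplus" "g ` Vminus = graph Z"
    using ex_graph[OF sub] by blast
  \<comment> \<open>Beyond n the vector \<open>e i\<close> is fixed by \<open>g\<close>, so it lies
    on the graph itself, and its V_+ component is 0.\<close>
  have Ze: "Z (e i) = 0" if "i > int n" for i
  proof -
    have "g (e i) = e i" using fx that by (simp add: fixes_beyond_def)
    then have "e i \<in> graph Z" using Z(2) e_Vminus[of i] that by (metis image_eqI le_less_trans of_nat_0_le_iff)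
    then show ?thesis using that by (simp add: graph_iff[OF Z(1)] pi_e)
  qed
  \<comment> \<open>Only the columns 1, ..., n can be nonzero, and each of them has finite
    support.\<close>
  have "{(j, i). matrix_of Z j i \<noteq> 0} \<subseteq> (\<Union>i\<in>{1..int n}. (\<lambda>k. (- k, i)) ` supp (Z (e i)))"
  proof clarify
    fix j i assume ne: "matrix_of Z j i \<noteq> 0"
    then have ji: "i > 0" "j > 0" "coord (Z (e i)) (- j) \<noteq> 0" by (auto simp: matrix_of_def split: if_splits)
    then have "i \<le> int n" using Ze[of i] by (cases "i > int n") auto
    moreover have "(j, i) \<in> (\<lambda>k. (- k, i)) ` supp (Z (e i))"
      by (rule image_eqI[of _ _ "- j"]) (use ji in \<open>auto simp: in_supp\<close>)
    ultimately show "(j, i) \<in> (\<Union>i\<in>{1..int n}. (\<lambda>k. (- k, i)) ` supp (Z (e i)))"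
      using ji(1) by (intro UN_I[of i]) auto
  qed
  then have "finitary_mat (matrix_of Z)"
    unfolding finitary_mat_def by (rule finite_subset) auto
  then have "Z \<in> Z_domain" using Z_domain_graph[OF Z(1)] neg Z(2) by simp
  with Z(2) show ?thesis by (rule that[rotated])
qed

subsection \<open>Transitivity\<close>

text \<open>As the V_- component of \<open>v i\<close> is \<open>e i\<close>, the vectors built by
  stage k have no coordinates beyond k, so the next one cannot depend on them. Vectors are
  normalized to -1 because h is negative on \<open>W\<close>; the support bound keeps the result in
  one finite block.\<close>

lemma gram_schmidt:
  assumes W: "VS.subspace W" and neg: "\<And>x. x \<in> W \<Longrightarrow> x \<noteq> 0 \<Longrightarrow> Re (hform x x) < 0"
    and v: "\<And>i. i \<in> {1..int n} \<Longrightarrow> v i \<in> W"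
      "\<And>i. i \<in> {1..int n} \<Longrightarrow> supp (v i) \<subseteq> {- int n..int n}"
      "\<And>i j. i \<in> {1..int n} \<Longrightarrow> j > 0 \<Longrightarrow> coord (v i) j = (if j = i then 1 else 0)"
    and "k \<le> n"
  shows "\<exists>f. \<forall>i\<in>{1..int k}. f i \<in> W \<and> supp (f i) \<subseteq> {- int n..int n} \<and>
      (\<forall>j>int k. coord (f i) j = 0) \<and> (\<forall>j\<in>{1..int k}. hform (f i) (f j) = (if i = j then - 1 else 0))"
  using \<open>k \<le> n\<close>
proof (induction k)
  case (Suc k)
  then obtain f where F: "\<forall>i\<in>{1..int k}. f i \<in> W \<and> supp (f i) \<subseteq> {- int n..int n} \<and>
      (\<forall>j>int k. coord (f i) j = 0) \<and> (\<forall>j\<in>{1..int k}. hform (f i) (f j) = (if i = j then - 1 else 0))"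
    by (meson Suc_leD)
  have f: "\<And>i. i \<in> {1..int k} \<Longrightarrow> f i \<in> W"
    "\<And>i. i \<in> {1..int k} \<Longrightarrow> supp (f i) \<subseteq> {- int n..int n}"
    "\<And>i j. i \<in> {1..int k} \<Longrightarrow> j > int k \<Longrightarrow> coord (f i) j = 0"
    "\<And>i j. i \<in> {1..int k} \<Longrightarrow> j \<in> {1..int k} \<Longrightarrow> hform (f i) (f j) = (if i = j then - 1 else 0)"
    using F by blast+
  define m where "m = int (Suc k)"
  have m: "m \<in> {1..int n}" "m > int k" using Suc.prems by (auto simp: m_def)
  \<comment> \<open>The correction carries a plus sign because h(f_j, f_j) = -1.\<close>
  define w where "w = v m + (\<Sum>j\<in>{1..int k}. scaleV (hform (v m) (f j)) (f j))"
  have coord_w: "coord w j = coord (v m) j + (\<Sum>i\<in>{1..int k}. hform (v m) (f i) * coord (f i) j)" for j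
    by (simp add: w_def coord_sum)
  have beyond: "coord w j = (if j = m then 1 else 0)" if "j \<ge> m" for j
    using that m f(3)[of _ j] v(3)[OF m(1), of j] by (simp add: coord_w)
  have supp_w: "supp w \<subseteq> {- int n..int n}"
  proof
    fix j assume "j \<in> supp w"
    then have "coord (v m) j \<noteq> 0 \<or> (\<exists>i\<in>{1..int k}. coord (f i) j \<noteq> 0)"
      unfolding in_supp coord_w
      by (metis (mono_tags, lifting) add.right_neutral mult_zero_right sum.neutral)
    then show "j \<in> {- int n..int n}"
      using v(2)[OF m(1)] f(2) by (auto simp: in_supp subset_iff)
  qed
  have wW: "w \<in> W"
    unfolding w_def by (intro VS.subspace_add[OF W] VS.subspace_sum[OF W] VS.subspace_scale[OF W] f v m)
  have orth: "hform w (f i) = 0" if "i \<in> {1..int k}" for i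
  proof -
    have "hform w (f i) = hform (v m) (f i) + (\<Sum>j\<in>{1..int k}. hform (v m) (f j) * hform (f j) (f i))"
      by (simp add: w_def hform_add_left hform_sum_left hform_scale_left)
    also have "(\<Sum>j\<in>{1..int k}. hform (v m) (f j) * hform (f j) (f i)) =
        (\<Sum>j\<in>{1..int k}. if j = i then - hform (v m) (f i) else 0)"
      using that by (intro sum.cong) (auto simp: f(4))
    finally show ?thesis using that by simp
  qed
  \<comment> \<open>Coordinate m of \<open>w\<close> is 1: it comes from \<open>v m\<close>
    alone.\<close>
  have "w \<noteq> 0" using beyond[of m] by force
  define r where "r = - Re (hform w w)"
  have r: "r > 0" using neg[OF wW \<open>w \<noteq> 0\<close>] by (simp add: r_def)
  have hww: "hform w w = - complex_of_real r"
    by (rule complex_eqI) (simp_all add: r_def Im_hform_self)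
  define u where "u = scaleV (complex_of_real (1 / sqrt r)) w"
  have huu: "hform u u = - 1"
    using r by (simp add: u_def hform_scale_left hform_scale_right hww flip: of_real_mult)
  have hu: "hform u (f i) = 0" "hform (f i) u = 0" if "i \<in> {1..int k}" for i
    using orth[OF that] hform_commute[of "f i" w]
    by (simp_all add: u_def hform_scale_left hform_scale_right)
  let ?f = "f(m := u)"
  have range: "{1..int (Suc k)} = insert m {1..int k}" by (auto simp: m_def)
  have nm: "i \<noteq> m" if "i \<in> {1..int k}" for i using that m by auto
  have "?f i \<in> W \<and> supp (?f i) \<subseteq> {- int n..int n} \<and>
      (\<forall>j>int (Suc k). coord (?f i) j = 0) \<and>
      (\<forall>j\<in>{1..int (Suc k)}. hform (?f i) (?f j) = (if i = j then - 1 else 0))"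
    if i: "i \<in> {1..int (Suc k)}" for i
  proof (cases "i = m")
    case True
    have "u \<in> W" unfolding u_def by (rule VS.subspace_scale[OF W wW])
    moreover have "supp u \<subseteq> {- int n..int n}" using supp_w supp_scale unfolding u_def by blast
    moreover have "\<forall>j>int (Suc k). coord u j = 0" using beyond by (simp add: u_def m_def)
    ultimately show ?thesis using True m(2) unfolding range by (auto simp: huu hu nm)
  next
    case False
    then have ik: "i \<in> {1..int k}" using i range by blast
    then show ?thesis using False f(1,2)[OF ik] f(3)[OF ik] unfolding range by (auto simp: hu nm f(4))
  qed
  then show ?case by blast
qed simp

lemma transitive_G0:
  assumes "Z \<in> Z_domain"
  obtains g where "g \<in> G0" "g ` Vminus = graph Z"
proof -
  have S: "Z \<in> skew_maps" using assms by (simp add: Z_domain_def)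
  note L = skew_maps_D(1)[OF S]
  have neg: "negative_isotropic (graph Z)"
    using Z_domain_graph[OF L skew_maps_D(2)[OF S]] assms by simp
  obtain n where n: "Z \<in> skew_level n" using skew_level_ex[OF S] .
  have sh: "shear Z (e i) \<in> graph Z" if "i > 0" for i
    using that by (auto simp: graph_def e_Vminus)
  have sh_supp: "supp (shear Z (e i)) \<subseteq> {- int n..int n}" if "i \<in> {1..int n}" for i
    using supp_isometry_e[OF fixes_beyond_shear[OF n] bform_shear[OF S]] that by simp
  have sh_coord: "coord (shear Z (e i)) j = (if j = i then 1 else 0)" if "i \<in> {1..int n}" "j > 0" for i j
    using that lin_maps_D(1)[OF L e_Vminus, of i] by (auto simp: shear_Vminus e_Vminus Vplus_iff)
  have "\<exists>f. \<forall>i\<in>{1..int n}. f i \<in> graph Z \<and> supp (f i) \<subseteq> {- int n..int n} \<and>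
      (\<forall>j>int n. coord (f i) j = 0) \<and> (\<forall>j\<in>{1..int n}. hform (f i) (f j) = (if i = j then - 1 else 0))"
    using neg sh sh_supp sh_coord
    by (intro gram_schmidt[where v = "\<lambda>i. shear Z (e i)"] subspace_graph[OF L])
      (auto simp: negative_isotropic_def)
  then obtain f where F: "\<forall>i\<in>{1..int n}. f i \<in> graph Z \<and> supp (f i) \<subseteq> {- int n..int n} \<and>
      (\<forall>j>int n. coord (f i) j = 0) \<and> (\<forall>j\<in>{1..int n}. hform (f i) (f j) = (if i = j then - 1 else 0))"
    by blast
  have f: "\<And>i. i \<in> {1..int n} \<Longrightarrow> f i \<in> graph Z"
    "\<And>i. i \<in> {1..int n} \<Longrightarrow> supp (f i) \<subseteq> {- int n..int n}"
    "\<And>i j. i \<in> {1..int n} \<Longrightarrow> j \<in> {1..int n} \<Longrightarrow> hform (f i) (f j) = (if i = j then - 1 else 0)"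
    using F by blast+
  \<comment> \<open>Beyond n the vectors \<open>e i\<close> already lie on the graph and are
    h-orthonormal, also to the \<open>f i\<close>; keeping them makes the map below fix almost all
    of the basis.\<close>
  define \<psi> where "\<psi> i = (if i > int n then e i else f i)" for i
  have \<psi>_graph: "\<psi> i \<in> graph Z" if "i > 0" for i
    using that f(1)[of i] sh[of i] fixes_beyond_shear[OF n] by (auto simp: \<psi>_def fixes_beyond_def)
  have f_beyond: "coord (f i) j = 0" if "i \<in> {1..int n}" "j > int n" for i j
    using f(2)[OF that(1)] that(2) by (auto simp: in_supp subset_iff)
  have h_\<psi>: "hform (\<psi> i) (\<psi> j) = (if i = j then - 1 else 0)" if "i > 0" "j > 0" for i j
  proof -
    have 1: "hform (f i) (e j) = 0" if "i \<in> {1..int n}" "j > int n" for i j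
      using f_beyond[OF that] by (simp add: hform_e_right)
    then have 2: "hform (e j) (f i) = 0" if "i \<in> {1..int n}" "j > int n" for i j
      using hform_commute[of "e j" "f i"] that by simp
    show ?thesis
      using that 1[of i j] 2[of j i] f(3)[of i j] by (auto simp: \<psi>_def hform_e)
  qed
  have b_\<psi>: "bform (\<psi> i) (\<psi> j) = 0" if "i > 0" "j > 0" for i j
    using neg \<psi>_graph that by (simp add: negative_isotropic_def)
  \<comment> \<open>Isotropy of the graph says that J sends it into its h-orthogonal
    complement.\<close>
  have h_J: "hform (\<psi> i) (J (\<psi> j)) = 0" if "i > 0" "j > 0" for i j
    using b_\<psi>[OF that] by (simp add: bform_J)
  \<comment> \<open>J reverses the sign of h, so the vectors \<open>J (\<psi> i)\<close> form a
    positive orthonormal family.\<close>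
  have J_h: "hform (J x) (J y) = - hform y x" for x y
    by (metis bform_J bform_commute J_J hform_minus_right)
  \<comment> \<open>The value on \<open>e (- i)\<close>, i > 0, is forced: the map must commute with
    J, and \<open>J (e i) = e (- i)\<close>.\<close>
  obtain g where lg: "lin g" and ge: "\<And>i. i \<noteq> 0 \<Longrightarrow> g (e i) = (if i > 0 then \<psi> i else J (\<psi> (- i)))"
    using ex_lin[of "\<lambda>i. if i > 0 then \<psi> i else J (\<psi> (- i))"] by blast
  have hg: "hform (g x) (g y) = hform x y" for x y
  proof (rule lin_hform[OF lg])
    fix i j :: int assume ij: "i \<noteq> 0" "j \<noteq> 0"
    have "hform (J (\<psi> a)) (\<psi> b) = 0" if "a > 0" "b > 0" for a b
      using h_J[OF that(2,1)] hform_commute[of "J (\<psi> a)" "\<psi> b"] by simp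
    then show "hform (g (e i)) (g (e j)) = hform (e i) (e j)"
      using ij by (auto simp: ge hform_e h_\<psi> h_J J_h)
  qed
  have bg: "bform (g x) (g y) = bform x y" for x y
  proof (rule lin_bform[OF lg])
    fix i j :: int assume ij: "i \<noteq> 0" "j \<noteq> 0"
    have bJ: "bform x (J y) = - hform x y" for x y
      by (simp add: bform_J J_J hform_minus_right)
    have Jb: "bform (J x) y = - hform y x" for x y
      using bJ[of y x] bform_commute by simp
    have "hform (J (\<psi> a)) (\<psi> b) = 0" if "a > 0" "b > 0" for a b
      using h_J[OF that(2,1)] hform_commute[of "J (\<psi> a)" "\<psi> b"] by simp
    then show "bform (g (e i)) (g (e j)) = bform (e i) (e j)"
      using ij by (auto simp: ge bform_e bJ Jb h_\<psi> b_\<psi>)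
  qed
  have fx: "fixes_beyond n g"
    unfolding fixes_beyond_def
  proof (intro allI impI)
    fix i :: int assume "\<bar>i\<bar> > int n"
    then show "g (e i) = e i" using ge[of i] J_e[of "- i"] by (auto simp: \<psi>_def)
  qed
  have "inj g"
  proof (rule injI)
    fix x y assume "g x = g y"
    then have "hform (x - y) z = 0" for z
      using hg[of "x - y" z] by (simp add: lin_diff[OF lg])
    then have "x - y = 0" by (rule hform_nondegenerate)
    then show "x = y" by simp
  qed
  moreover from this have "surj g"
    by (rule lin_inj_surj[OF lg]) (use fx supp_isometry_e[OF fx bg] in \<open>auto simp: fixes_beyond_def\<close>)
  ultimately have "bij g" by (simp add: bij_def)
  have g_graph: "g x \<in> graph Z" if "x \<in> Vminus" for x
  proof -
    have "g (e i) \<in> graph Z" if "i > 0" for i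
      using \<psi>_graph[OF that] ge[of i] that by simp
    then have "(\<Sum>i\<in>supp x. scaleV (coord x i) (g (e i))) \<in> graph Z"
      using Vminus_supp_pos[OF that] subspace_graph[OF L]
      by (intro VS.subspace_sum VS.subspace_scale) auto
    then show ?thesis by (simp flip: lin_expand[OF lg])
  qed
  \<comment> \<open>This is (1 + Z)^{-1} g. It maps V_- into itself because \<open>g\<close> maps
    V_- into the graph, so g = (1 + Z) p is a product of two maps whose determinants are known to be
    1.\<close>
  define p where "p x = g x - Z (pi_minus (g x))" for x
  have pi_p: "pi_minus (p x) = pi_minus (g x)" for x
    using lin_maps_D(1)[OF L pi_minus_in[of "g x"]]
    by (intro V_eqI) (simp add: p_def coord_pi_minus Vplus_iff)
  then have g_p: "g = shear Z \<circ> p" by (auto simp: shear_def p_def)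
  have bp: "bform (p x) (p y) = bform x y" for x y
    using bform_shear[OF S, of "p x" "p y"] bg[of x y] by (simp add: g_p)
  have fp: "fixes_beyond n p"
    using fx fixes_beyond_shear[OF n] by (auto simp: fixes_beyond_def p_def shear_def)
  have "p x \<in> Vminus" if "x \<in> Vminus" for x
  proof -
    have "p x = pi_minus (g x)"
      using g_graph[OF that] pi_decomp[of "g x"] by (simp add: p_def graph_iff[OF L] algebra_simps)
    then show ?thesis by simp
  qed
  then have "fin_det p = 1" by (rule fin_det_stabilizer[OF fp bp])
  moreover have "fin_det g = fin_det (shear Z) * fin_det p"
    unfolding g_p by (rule fin_det_comp[OF lin_shear[OF L] fixes_beyond_shear[OF n] fp bp])
  ultimately have "fin_det g = 1" by (simp add: fin_det_shear[OF n])
  then have gG: "g \<in> G" by (intro G_I[OF lg \<open>bij g\<close> fx _ bg])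
  \<comment> \<open>So far g V_- is only contained in the graph; equality holds since g V_- is
    maximal isotropic.\<close>
  have "graph Z = g ` Vminus"
    using neg g_graph by (intro isotropic_Vminus_maximal[OF gG]) (auto simp: negative_isotropic_def)
  moreover have "g \<in> G0" using gG hg by (simp add: G0_def)
  ultimately show ?thesis using that by blast
qed

text \<open>The image under \<open>g\<close> of the point y + Z y has V_- component (CZ + D)y and
  V_+ component (AZ + B)y. It runs over the graph of Z', so CZ + D is a composite of bijections and
  Z' sends the first component to the second.\<close>

lemma frac_act_graph:
  assumes g: "g \<in> G0" and Z: "Z \<in> lin_maps Vminus Vplus" and Z': "Z' \<in> lin_maps Vminus Vplus"
    and gZ: "g ` graph Z = graph Z'"
  shows "bij_betw (denom g Z) Vminus Vminus" "frac_act g Z = Z'"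
proof -
  have gG: "g \<in> G" using g by (simp add: G0_def)
  note lg = G_D(1)[OF gG]
  have denom: "denom g Z y = pi_minus (g (shear Z y))"
    and numer: "numer g Z y = pi_plus (g (shear Z y))" if "y \<in> Vminus" for y
    using that lin_maps_D(1)[OF Z that]
    by (simp_all add: denom_def numer_def block_def shear_Vminus lin_add[OF lg] pi_add add.commute)
  have "bij_betw g (graph Z) (graph Z')"
    using gZ bij_is_inj[OF G_D(2)[OF gG]] unfolding bij_betw_def by (blast intro: inj_on_subset)
  then have "bij_betw (pi_minus \<circ> (g \<circ> shear Z)) Vminus Vminus"
    using bij_shear_graph[OF Z] bij_pi_minus_graph[OF Z'] by (blast intro: bij_betw_trans)
  then show bij: "bij_betw (denom g Z) Vminus Vminus"
    by (simp add: denom cong: bij_betw_cong)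
  show "frac_act g Z = Z'"
  proof
    fix w
    show "frac_act g Z w = Z' w"
    proof (cases "w \<in> Vminus")
      case True
      define y where "y = inv_into Vminus (denom g Z) w"
      have y: "y \<in> Vminus" "denom g Z y = w"
        using bij True by (auto simp: y_def bij_betw_def inv_into_into f_inv_into_f)
      have "g (shear Z y) \<in> graph Z'" using gZ y(1) by (auto simp: graph_def)
      then have "numer g Z y = Z' w" using y by (simp add: denom numer graph_iff[OF Z'])
      then show ?thesis using True by (simp add: frac_act_def compose_def y_def)
    qed (simp add: frac_act_def compose_def lin_maps_D(2)[OF Z'])
  qed
qed

subsection \<open>The bounded domain\<close>

lemma skew_levelD:
  assumes "Z \<in> skew_level n"
  shows "Z \<in> skew_maps" "Z \<in> lin_maps Vminus Vplus"
    "matrix_of Z j i \<noteq> 0 \<Longrightarrow> j \<in> {1..int n} \<and> i \<in> {1..int n}"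
  using assms by (auto simp: skew_level_def skew_maps_def matrix_of_def split: if_splits)

text \<open>Expresses h on the graph through the n x n block of the matrix, hence as a function of
  finitely many entries; coordinates of x beyond n enter only the subtracted norm.\<close>

lemma Re_hform_shear:
  assumes Z: "Z \<in> skew_level n" and x: "x \<in> Vminus"
  shows "Re (hform (shear Z x) (shear Z x)) =
    (\<Sum>j\<in>{1..int n}. (cmod (\<Sum>i\<in>{1..int n}. matrix_of Z j i * coord x i))\<^sup>2) -
    (\<Sum>i\<in>supp x. (cmod (coord x i))\<^sup>2)"
proof -
  note D = skew_levelD[OF Z]
  let ?I = "{1..int n}"
  have c: "coord (Z x) (- j) = (\<Sum>i\<in>?I. matrix_of Z j i * coord x i)" if "j > 0" for j
  proof -
    have "coord (Z x) (- j) = (\<Sum>i\<in>supp x. matrix_of Z j i * coord x i)"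
      by (rule coord_apply[OF D(2) x that])
    also have "\<dots> = (\<Sum>i\<in>supp x \<inter> ?I. matrix_of Z j i * coord x i)"
      using D(3)[of j] by (intro sum.mono_neutral_right) auto
    also have "\<dots> = (\<Sum>i\<in>?I. matrix_of Z j i * coord x i)"
      by (intro sum.mono_neutral_left) (auto simp: in_supp)
    finally show ?thesis .
  qed
  have ZV: "Z x \<in> Vplus" by (rule lin_maps_D(1)[OF D(2) x])
  have "supp (Z x) \<subseteq> uminus ` ?I"
  proof
    fix i assume i: "i \<in> supp (Z x)"
    then have "i < 0" by (rule Vplus_supp_neg[OF ZV])
    with i have "(\<Sum>k\<in>?I. matrix_of Z (- i) k * coord x k) \<noteq> 0"
      using c[of "- i"] by (simp add: in_supp)
    then obtain k where "matrix_of Z (- i) k \<noteq> 0"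
      by (metis (no_types, lifting) mult_zero_left sum.neutral)
    then have "- i \<in> ?I" using D(3) by blast
    then show "i \<in> uminus ` ?I" by (rule image_eqI[rotated]) simp
  qed
  then have "hform (Z x) (Z x) = complex_of_real (\<Sum>i\<in>uminus ` ?I. (cmod (coord (Z x) i))\<^sup>2)"
    by (intro hform_self_Vplus[OF ZV]) auto
  also have "(\<Sum>i\<in>uminus ` ?I. (cmod (coord (Z x) i))\<^sup>2) =
      (\<Sum>j\<in>?I. (cmod (\<Sum>i\<in>?I. matrix_of Z j i * coord x i))\<^sup>2)"
    by (subst sum.reindex) (auto simp: inj_on_def c)
  finally show ?thesis
    by (simp add: hform_shear[OF D(2) x] hform_self_Vminus[OF x, of "supp x"])
qed

text \<open>Pinning the values off \<open>I\<close> to 0 makes the sphere compact in the product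
  topology on functions on all integers.\<close>

definition sphere_on :: "int set \<Rightarrow> (int \<Rightarrow> complex) set" where
  "sphere_on I = {x. (\<forall>i. i \<notin> I \<longrightarrow> x i = 0) \<and> (\<Sum>i\<in>I. (cmod (x i))\<^sup>2) = 1}"

text \<open>The sphere is a closed subset of a product of unit discs over \<open>I\<close> and
  single points elsewhere, which is compact by Tychonoff's theorem.\<close>

lemma compact_sphere_on:
  assumes "finite I"
  shows "compact (sphere_on I)"
proof -
  define B where "B = (\<Pi>\<^sub>E i\<in>UNIV. if i \<in> I then cball 0 1 else {0 :: complex})"
  have "compactin (product_topology (\<lambda>i. euclidean) UNIV) B"
    unfolding B_def compactin_PiE by auto
  then have B: "compact B" by (simp add: euclidean_product_topology)
  have "continuous_on UNIV (\<lambda>x::int \<Rightarrow> complex. \<Sum>i\<in>I. (cmod (x i))\<^sup>2)"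
    by (intro continuous_intros continuous_on_product_coordinates)
  then have "closed {x::int \<Rightarrow> complex. (\<Sum>i\<in>I. (cmod (x i))\<^sup>2) = 1}"
    by (intro closed_Collect_eq continuous_on_const)
  then have "compact (B \<inter> {x. (\<Sum>i\<in>I. (cmod (x i))\<^sup>2) = 1})"
    using B by (rule compact_Int_closed[rotated])
  moreover have "sphere_on I = B \<inter> {x. (\<Sum>i\<in>I. (cmod (x i))\<^sup>2) = 1}"
  proof
    show "sphere_on I \<subseteq> B \<inter> {x. (\<Sum>i\<in>I. (cmod (x i))\<^sup>2) = 1}"
    proof
      fix x assume x: "x \<in> sphere_on I"
      have "cmod (x i) \<le> 1" if "i \<in> I" for i
      proof -
        have "(cmod (x i))\<^sup>2 \<le> (\<Sum>i\<in>I. (cmod (x i))\<^sup>2)"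
          using that assms by (intro member_le_sum) auto
        then show ?thesis using x by (simp add: sphere_on_def power_le_one_iff abs_square_le_1)
      qed
      then show "x \<in> B \<inter> {x. (\<Sum>i\<in>I. (cmod (x i))\<^sup>2) = 1}"
        using x by (auto simp: B_def sphere_on_def PiE_def Pi_def)
    qed
    show "B \<inter> {x. (\<Sum>i\<in>I. (cmod (x i))\<^sup>2) = 1} \<subseteq> sphere_on I"
      by (auto simp: B_def sphere_on_def PiE_def Pi_def split: if_splits)
  qed
  ultimately show ?thesis by simp
qed

text \<open>The form |x|^2 - |Mx|^2 of the block of \<open>M\<close> indexed by \<open>I\<close>,
  taken as a function of both arguments for the sake of joint continuity.\<close>

definition gap :: "int set \<Rightarrow> imat \<times> (int \<Rightarrow> complex) \<Rightarrow> real" where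
  "gap I = (\<lambda>(M, x). (\<Sum>i\<in>I. (cmod (x i))\<^sup>2) - (\<Sum>j\<in>I. (cmod (\<Sum>i\<in>I. M j i * x i))\<^sup>2))"

lemma continuous_gap: "continuous_on UNIV (gap I)"
proof -
  note coordinatewise = continuous_on_product_then_coordinatewise
  have fst: "continuous_on UNIV (\<lambda>p :: imat \<times> (int \<Rightarrow> complex). fst p j i)" for j i
    by (rule coordinatewise[OF coordinatewise[OF continuous_on_fst[OF continuous_on_id]]])
  have snd: "continuous_on UNIV (\<lambda>p :: imat \<times> (int \<Rightarrow> complex). snd p i)" for i
    by (rule coordinatewise[OF continuous_on_snd[OF continuous_on_id]])
  show ?thesis
    unfolding gap_def case_prod_beta by (intro continuous_intros fst snd)
qed

text \<open>By the tube lemma, positivity on {M} times the compact sphere persists for all matrices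
  near M.\<close>

lemma open_positive_gap:
  assumes "finite I"
  shows "open {M. \<forall>x\<in>sphere_on I. gap I (M, x) > 0}"
proof (subst open_subopen, intro ballI)
  fix M assume "M \<in> {M. \<forall>x\<in>sphere_on I. gap I (M, x) > 0}"
  then have sub: "{M} \<times> sphere_on I \<subseteq> {p. gap I p > 0}" by auto
  have "open {p. gap I p > 0}"
    by (intro open_Collect_less continuous_on_const continuous_gap)
  from Elementary_Topology.tube_lemma[OF compact_sphere_on[OF assms] this sub]
  obtain X where X: "M \<in> X \<and> open X \<and> X \<times> sphere_on I \<subseteq> {p. gap I p > 0}" ..
  then have "X \<subseteq> {M. \<forall>x\<in>sphere_on I. gap I (M, x) > 0}" by auto
  with X have "open X \<and> M \<in> X \<and> X \<subseteq> {M. \<forall>x\<in>sphere_on I. gap I (M, x) > 0}" by simp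
  then show "\<exists>T. open T \<and> M \<in> T \<and> T \<subseteq> {M. \<forall>x\<in>sphere_on I. gap I (M, x) > 0}" by (rule exI)
qed

text \<open>By homogeneity unit vectors suffice, and coordinates of x beyond n only increase |x|^2
  while leaving Zx unchanged.\<close>

lemma Z_domain_gap:
  assumes Z: "Z \<in> skew_level n"
  shows "Z \<in> Z_domain \<longleftrightarrow> (\<forall>x\<in>sphere_on {1..int n}. gap {1..int n} (matrix_of Z, x) > 0)"
proof -
  let ?I = "{1..int n}" and ?M = "matrix_of Z"
  show ?thesis
    unfolding Z_domain_iff[OF skew_levelD(1)[OF Z]]
  proof (intro iffI ballI impI)
    fix x assume neg: "\<forall>x\<in>Vminus. x \<noteq> 0 \<longrightarrow> Re (hform (shear Z x) (shear Z x)) < 0"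
      and x: "x \<in> sphere_on ?I"
    have sub: "{i. x i \<noteq> 0} \<subseteq> ?I" using x by (auto simp: sphere_on_def)
    then have "finite {i. x i \<noteq> 0}" by (rule finite_subset) simp
    moreover have "x 0 = 0" using x by (auto simp: sphere_on_def)
    ultimately have c: "coord (Abs_V x) = x" by (simp add: Abs_V_inverse)
    have "Abs_V x \<in> Vminus" using sub by (auto simp: Vminus_iff c)
    moreover have "Abs_V x \<noteq> 0"
    proof
      assume "Abs_V x = 0"
      then have "x i = 0" for i using c by (metis coord_simps(1))
      then show False using x by (simp add: sphere_on_def)
    qed
    ultimately have "Re (hform (shear Z (Abs_V x)) (shear Z (Abs_V x))) < 0" using neg by blast
    moreover have "(\<Sum>i\<in>supp (Abs_V x). (cmod (x i))\<^sup>2) = (\<Sum>i\<in>?I. (cmod (x i))\<^sup>2)"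
      using sub by (intro sum.mono_neutral_left) (auto simp: in_supp c)
    ultimately show "gap ?I (?M, x) > 0"
      by (simp add: Re_hform_shear[OF Z \<open>Abs_V x \<in> Vminus\<close>] c gap_def)
  next
    fix x assume pos: "\<forall>x\<in>sphere_on ?I. gap ?I (?M, x) > 0" and x: "x \<in> Vminus" "x \<noteq> 0"
    let ?s = "\<Sum>i\<in>?I. (cmod (coord x i))\<^sup>2"
    let ?t = "\<Sum>j\<in>?I. (cmod (\<Sum>i\<in>?I. ?M j i * coord x i))\<^sup>2"
    have "?s = (\<Sum>i\<in>supp x \<inter> ?I. (cmod (coord x i))\<^sup>2)"
      by (intro sum.mono_neutral_right) (auto simp: in_supp)
    also have "\<dots> \<le> (\<Sum>i\<in>supp x. (cmod (coord x i))\<^sup>2)"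
      by (intro sum_mono2) auto
    finally have s_le: "?s \<le> (\<Sum>i\<in>supp x. (cmod (coord x i))\<^sup>2)" .
    have "?t < (\<Sum>i\<in>supp x. (cmod (coord x i))\<^sup>2)"
    proof (cases "?s = 0")
      \<comment> \<open>Here x has no coordinates in the block, so Zx vanishes while x does
        not.\<close>
      case True
      then have "coord x i = 0" if "i \<in> ?I" for i
        using that by (simp add: sum_nonneg_eq_0_iff)
      then have "?t = 0" by simp
      moreover have "(\<Sum>i\<in>supp x. (cmod (coord x i))\<^sup>2) > 0"
        using negative_isotropic_Vminus x
        by (auto simp: negative_isotropic_def hform_self_Vminus[OF x(1), of "supp x"])
      ultimately show ?thesis by simp
    next
      case False
      then have s: "?s > 0" by (simp add: sum_nonneg less_le)
      \<comment> \<open>The factor that moves the block part of x onto the unit sphere.\<close>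
      define r where "r = 1 / sqrt ?s"
      have r2: "r\<^sup>2 = 1 / ?s" using s by (simp add: r_def power_divide)
      let ?y = "\<lambda>i. if i \<in> ?I then complex_of_real r * coord x i else 0"
      have "(\<Sum>i\<in>?I. (cmod (?y i))\<^sup>2) = r\<^sup>2 * ?s"
        by (simp add: norm_mult power_mult_distrib sum_distrib_left)
      also have "\<dots> = 1" using s by (simp add: r2)
      finally have one: "(\<Sum>i\<in>?I. (cmod (?y i))\<^sup>2) = 1" .
      then have "?y \<in> sphere_on ?I" by (simp add: sphere_on_def)
      then have "gap ?I (?M, ?y) > 0" using pos by blast
      moreover have "(\<Sum>i\<in>?I. ?M j i * ?y i) = complex_of_real r * (\<Sum>i\<in>?I. ?M j i * coord x i)" for j
        unfolding sum_distrib_left by (intro sum.cong) auto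
      then have "(\<Sum>j\<in>?I. (cmod (\<Sum>i\<in>?I. ?M j i * ?y i))\<^sup>2) = r\<^sup>2 * ?t"
        by (simp only: norm_mult power_mult_distrib norm_of_real power2_abs) (simp add: sum_distrib_left)
      ultimately have "r\<^sup>2 * ?t < 1"
        unfolding gap_def case_prod_conv one by linarith
      then have "?t < ?s" using s by (simp add: r2 field_simps)
      with s_le show ?thesis by linarith
    qed
    then show "Re (hform (shear Z x) (shear Z x)) < 0"
      by (simp add: Re_hform_shear[OF Z x(1)])
  qed
qed

lemma openin_Z_domain: "openin skew_topology Z_domain"
  unfolding openin_skew_topology skew_open_def
proof (intro conjI allI)
  show "Z_domain \<subseteq> skew_maps" by (auto simp: Z_domain_def)
  fix n
  have "Z_domain \<inter> skew_level n =
      matrix_of -` {M. \<forall>x\<in>sphere_on {1..int n}. gap {1..int n} (M, x) > 0} \<inter> skew_level n"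
    using Z_domain_gap by auto
  then show "openin (pullback_topology (skew_level n) matrix_of euclidean) (Z_domain \<inter> skew_level n)"
    unfolding openin_pullback_topology using open_positive_gap[of "{1..int n}"]
    by (auto simp flip: open_openin)
qed

lemma topspace_skew_topology: "topspace skew_topology = skew_maps"
proof
  have "skew_open skew_maps"
    unfolding skew_open_def openin_pullback_topology
    by (auto simp: skew_level_def intro!: exI[of _ UNIV])
  then show "skew_maps \<subseteq> topspace skew_topology"
    by (simp add: openin_subset flip: openin_skew_topology)
  show "topspace skew_topology \<subseteq> skew_maps"
    by (auto simp: topspace_def openin_skew_topology skew_open_def)
qed

section \<open>Connectedness along segments through 0, and boundedness\<close>

definition scale_map :: "(V \<Rightarrow> V) \<Rightarrow> real \<Rightarrow> V \<Rightarrow> V" where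
  "scale_map Z t = (\<lambda>y\<in>Vminus. scaleV (complex_of_real t) (Z y))"

lemma matrix_of_scale_map: "matrix_of (scale_map Z t) = (\<lambda>j i. complex_of_real t * matrix_of Z j i)"
  by (intro ext) (simp add: matrix_of_def scale_map_def e_Vminus)

lemma scale_map_level:
  assumes Z: "Z \<in> skew_level n"
  shows "scale_map Z t \<in> skew_level n"
proof -
  note D = skew_levelD[OF Z]
  have "scale_map Z t \<in> lin_maps Vminus Vplus"
    using D(2) by (auto simp: lin_maps_def scale_map_def VS.subspace_scale[OF subspace_Vplus]
        VS.subspace_scale[OF subspace_Vminus] VS.subspace_add[OF subspace_Vminus] VS.scale_right_distrib
        PiE_iff mult.commute)
  moreover have "finitary_mat (matrix_of (scale_map Z t))"
    using skew_maps_D(2)[OF D(1)] unfolding finitary_mat_def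
    by (rule rev_finite_subset) (auto simp: matrix_of_scale_map)
  moreover have "antisymmetric_mat (matrix_of (scale_map Z t))"
    unfolding antisymmetric_mat_def matrix_of_scale_map
    using skew_maps_D(3)[OF D(1)] unfolding antisymmetric_mat_def by (metis mult_minus_right)
  ultimately show ?thesis using Z by (auto simp: skew_level_def skew_maps_def matrix_of_scale_map)
qed

lemma scale_map_Z_domain:
  assumes Z: "Z \<in> Z_domain" and t: "t \<in> {0..1}"
  shows "scale_map Z t \<in> Z_domain"
proof -
  have S: "Z \<in> skew_maps" using Z by (simp add: Z_domain_def)
  obtain n where n: "Z \<in> skew_level n" using skew_level_ex[OF S] .
  show ?thesis
    unfolding Z_domain_gap[OF scale_map_level[OF n]]
  proof
    fix x assume "x \<in> sphere_on {1..int n}"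
    then have "gap {1..int n} (matrix_of Z, x) > 0" using Z Z_domain_gap[OF n] by blast
    let ?t = "\<Sum>j\<in>{1..int n}. (cmod (\<Sum>i\<in>{1..int n}. matrix_of Z j i * x i))\<^sup>2"
    have "(\<Sum>j\<in>{1..int n}. (cmod (\<Sum>i\<in>{1..int n}. complex_of_real t * matrix_of Z j i * x i))\<^sup>2) = t\<^sup>2 * ?t"
      by (simp add: mult.assoc norm_mult power_mult_distrib flip: sum_distrib_left)
    moreover have "t\<^sup>2 * ?t \<le> 1 * ?t"
      using t by (intro mult_right_mono) (auto simp: power_le_one sum_nonneg)
    ultimately show "gap {1..int n} (matrix_of (scale_map Z t), x) > 0"
      using \<open>gap {1..int n} (matrix_of Z, x) > 0\<close> by (simp add: gap_def matrix_of_scale_map)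
  qed
qed

text \<open>The whole segment stays in the level of Z, so the direct limit topology reduces to
  entrywise continuity of t |-> t M.\<close>

lemma continuous_scale_map:
  assumes "Z \<in> skew_maps"
  shows "continuous_map (top_of_set {0..1}) skew_topology (scale_map Z)"
  unfolding continuous_map_def topspace_skew_topology
proof (intro conjI allI impI)
  obtain n where n: "Z \<in> skew_level n" using skew_level_ex[OF assms] .
  show "scale_map Z \<in> topspace (top_of_set {0..1}) \<rightarrow> skew_maps"
    using scale_map_level[OF n] skew_levelD(1) by blast
  fix U assume "openin skew_topology U"
  then have "openin (pullback_topology (skew_level n) matrix_of euclidean) (U \<inter> skew_level n)"
    by (simp add: openin_skew_topology skew_open_def)
  then obtain A where "open A \<and> U \<inter> skew_level n = matrix_of -` A \<inter> skew_level n"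
    unfolding openin_pullback_topology open_openin[symmetric] ..
  then have A: "open A" "U \<inter> skew_level n = matrix_of -` A \<inter> skew_level n" by simp_all
  let ?h = "\<lambda>t j i. complex_of_real t * matrix_of Z j i"
  have "continuous_on UNIV ?h"
    by (intro continuous_on_coordinatewise_then_product continuous_intros)
  then have "open (?h -` A)" using A(1) by (simp add: open_vimage)
  moreover have "scale_map Z t \<in> U \<longleftrightarrow> t \<in> ?h -` A" for t
  proof -
    have "scale_map Z t \<in> U \<longleftrightarrow> matrix_of (scale_map Z t) \<in> A"
      using A(2) scale_map_level[OF n, of t] by blast
    then show ?thesis by (simp add: matrix_of_scale_map)
  qed
  then have "{t \<in> topspace (top_of_set {0..1}). scale_map Z t \<in> U} = {0..1} \<inter> ?h -` A"
    by auto
  ultimately show "openin (top_of_set {0..1}) {t \<in> topspace (top_of_set {0..1}). scale_map Z t \<in> U}"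
    by (simp add: openin_open_Int)
qed

lemma zero_in_Z_domain: "(\<lambda>y\<in>Vminus. 0) \<in> Z_domain" (is "?Z \<in> _")
proof -
  have M: "matrix_of ?Z = (\<lambda>j i. 0)" by (intro ext) (simp add: matrix_of_def e_Vminus)
  have "?Z \<in> lin_maps Vminus Vplus"
    by (auto simp: lin_maps_def VS.subspace_0[OF subspace_Vplus] VS.subspace_scale[OF subspace_Vminus]
        VS.subspace_add[OF subspace_Vminus])
  then have S: "?Z \<in> skew_maps"
    by (simp add: skew_maps_def M finitary_mat_def antisymmetric_mat_def)
  show ?thesis
    using negative_isotropic_Vminus by (simp add: Z_domain_iff[OF S] shear_Vminus negative_isotropic_def)
qed

lemma connectedin_Z_domain: "connectedin skew_topology Z_domain"
proof -
  let ?P = "(\<lambda>Z. scale_map Z ` {0..1}) ` Z_domain"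
  have S: "Z \<in> skew_maps" if "Z \<in> Z_domain" for Z using that by (simp add: Z_domain_def)
  have "connectedin (top_of_set {0..1::real}) {0..1}" by (simp add: connectedin_subtopology)
  then have conn: "connectedin skew_topology P" if "P \<in> ?P" for P
    using that S by (auto intro: connectedin_continuous_map_image[OF continuous_scale_map])
  have "scale_map Z 0 = (\<lambda>y\<in>Vminus. 0)" for Z by (auto simp: scale_map_def)
  then have "(\<lambda>y\<in>Vminus. 0) \<in> \<Inter>?P" by (auto simp: image_iff intro!: bexI[of _ 0])
  then have "\<Inter>?P \<noteq> {}" by blast
  with conn have "connectedin skew_topology (\<Union>?P)" by (rule connectedin_Union)
  moreover have "\<Union>?P = Z_domain"
  proof
    show "\<Union>?P \<subseteq> Z_domain" using scale_map_Z_domain by blast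
    show "Z_domain \<subseteq> \<Union>?P"
    proof
      fix Z assume Z: "Z \<in> Z_domain"
      have "Z = scale_map Z 1"
        using lin_maps_D(2)[OF skew_maps_D(1)[OF S[OF Z]]] by (auto simp: scale_map_def)
      then show "Z \<in> \<Union>?P" using Z by (intro UnionI[of "scale_map Z ` {0..1}"]) (auto intro: image_eqI[of _ _ 1])
    qed
  qed
  ultimately show ?thesis by simp
qed

lemma bounded_domain_Z_domain: "bounded_domain Z_domain"
proof -
  \<comment> \<open>The bound M = 1 works because h is nonpositive on the graph, which means |Zx|^2
    <= |x|^2.\<close>
  have "vnorm (Z x) \<le> 1 * vnorm x" if Z: "Z \<in> Z_domain" and x: "x \<in> Vminus" for Z x
  proof -
    have S: "Z \<in> skew_maps" using Z by (simp add: Z_domain_def)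
    note L = skew_maps_D(1)[OF S]
    have "Re (hform (shear Z x) (shear Z x)) \<le> 0"
    proof (cases "x = 0")
      case True
      then show ?thesis by (simp add: lin_zero[OF lin_shear[OF L]])
    next
      case False
      then show ?thesis using Z x Z_domain_iff[OF S] by (auto simp: less_imp_le)
    qed
    then show ?thesis
      using hform_self_Vminus[OF x, of "supp x"] hform_self_Vplus[OF lin_maps_D(1)[OF L x], of "supp (Z x)"]
      by (simp add: hform_shear[OF L x] vnorm_def)
  qed
  then show ?thesis
    unfolding bounded_domain_def
    using zero_in_Z_domain openin_Z_domain connectedin_Z_domain by blast
qed

subsection \<open>The realization\<close>

lemma flag_act_base:
  assumes "g \<in> G"
  shows "flag_act g base_flag = ({0}, g ` Vminus, UNIV)"
  using lin_zero[OF G_D(1)[OF assms]] bij_is_surj[OF G_D(2)[OF assms]]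
  by (simp add: flag_act_def base_flag_def)

text \<open>One direction holds because \<open>G0\<close> preserves the negativity and isotropy of
  V_-, the other by transitivity of \<open>G0\<close> on such graphs.\<close>

lemma D0_iff_graph:
  "F \<in> D0 \<longleftrightarrow> (\<exists>Z\<in>Z_domain. F = ({0}, graph Z, UNIV))"
proof
  assume "F \<in> D0"
  then obtain g where g: "g \<in> G0" "F = flag_act g base_flag" by (auto simp: D0_def)
  then have gG: "g \<in> G" by (simp add: G0_def)
  have "F = ({0}, g ` Vminus, UNIV)"
    using g(2) by (simp add: flag_act_base[OF gG])
  then show "\<exists>Z\<in>Z_domain. F = ({0}, graph Z, UNIV)"
    using graph_of_negative[OF gG negative_isotropic_G0[OF g(1) negative_isotropic_Vminus]] by metis
next
  assume "\<exists>Z\<in>Z_domain. F = ({0}, graph Z, UNIV)"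
  then obtain Z where Z: "Z \<in> Z_domain" "F = ({0}, graph Z, UNIV)" by blast
  obtain g where g: "g \<in> G0" "g ` Vminus = graph Z" using transitive_G0[OF Z(1)] .
  then have gG: "g \<in> G" by (simp add: G0_def)
  have "F = flag_act g base_flag"
    using Z(2) g(2) by (simp add: flag_act_base[OF gG])
  then show "F \<in> D0" using g(1) by (simp add: D0_def)
qed

lemma flag_act_D0:
  assumes "g \<in> G0" "F \<in> D0"
  shows "flag_act g F \<in> D0"
proof -
  obtain k where k: "k \<in> G0" "F = flag_act k base_flag" using assms(2) by (auto simp: D0_def)
  then have "flag_act g F = flag_act (g \<circ> k) base_flag"
    by (auto simp: flag_act_def base_flag_def image_comp)
  then show ?thesis using G0_comp[OF assms(1) k(1)] by (simp add: D0_def)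
qed

lemma maximal_negative_isotropic_G:
  assumes g: "g \<in> G" and neg: "negative_isotropic (g ` Vminus)"
  shows "maximal_negative_isotropic (g ` Vminus)"
  unfolding maximal_negative_isotropic_def
proof (intro conjI allI impI neg, elim conjE)
  fix W assume "negative_isotropic W" "g ` Vminus \<subseteq> W"
  then show "W = g ` Vminus"
    by (intro isotropic_Vminus_maximal[OF g]) (auto simp: negative_isotropic_def)
qed

theorem proposition4p3p2:
  shows "D0 = {(F0, F1, F2) \<in> flag_manifold.
                 F0 = {0} \<and> F2 = UNIV \<and> maximal_negative_isotropic F1}
    \<and> bounded_domain Z_domain
    \<and> (\<forall>F1. ({0}, F1, UNIV) \<in> D0 \<longrightarrow>
         bij_betw pi_minus F1 Vminus \<and>
         (\<forall>x\<in>F1. realization ({0}, F1, UNIV) (pi_minus x) = pi_plus x))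
    \<and> bij_betw realization D0 Z_domain
    \<and> (\<forall>g\<in>G0. \<forall>Z\<in>Z_domain.
         bij_betw (denom g Z) Vminus Vminus \<and> frac_act g Z \<in> Z_domain)
    \<and> (\<forall>g\<in>G0. \<forall>F\<in>D0. flag_act g F \<in> D0 \<and>
         realization (flag_act g F) = frac_act g (realization F))"
proof (intro conjI allI impI ballI)
  have L: "Z \<in> lin_maps Vminus Vplus" if "Z \<in> Z_domain" for Z
    using that by (simp add: Z_domain_def skew_maps_def)
  show "D0 = {(F0, F1, F2) \<in> flag_manifold. F0 = {0} \<and> F2 = UNIV \<and> maximal_negative_isotropic F1}"
    (is "_ = ?R")
  proof (intro Set.set_eqI iffI)
    fix F assume "F \<in> D0"
    then obtain g where g: "g \<in> G0" "F = flag_act g base_flag" by (auto simp: D0_def)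
    then have gG: "g \<in> G" by (simp add: G0_def)
    have "F = ({0}, g ` Vminus, UNIV)"
      using g(2) by (simp add: flag_act_base[OF gG])
    moreover have "maximal_negative_isotropic (g ` Vminus)"
      by (rule maximal_negative_isotropic_G[OF gG negative_isotropic_G0[OF g(1) negative_isotropic_Vminus]])
    moreover have "F \<in> flag_manifold" using g(2) gG by (simp add: flag_manifold_def)
    ultimately show "F \<in> ?R" by simp
  next
    \<comment> \<open>The middle space is g V_- for some g in \<open>G\<close> and is negative,
      hence a graph over the domain; all these graphs lie in a single
      \<open>G0\<close>-orbit.\<close>
    fix F assume "F \<in> ?R"
    then obtain F1 where F: "F \<in> flag_manifold" "F = ({0}, F1, UNIV)" "negative_isotropic F1"
      by (auto simp: maximal_negative_isotropic_def)
    then obtain g where g: "g \<in> G" "F1 = g ` Vminus"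
      by (auto simp: flag_manifold_def flag_act_def base_flag_def)
    then obtain Z where "Z \<in> Z_domain" "F1 = graph Z"
      using graph_of_negative[OF g(1)] F(3) by metis
    then show "F \<in> D0" using F(2) D0_iff_graph by blast
  qed
  show "bounded_domain Z_domain" by (rule bounded_domain_Z_domain)
  fix F1 assume "({0}, F1, UNIV) \<in> D0"
  then obtain Z where Z: "Z \<in> Z_domain" "F1 = graph Z" by (auto simp: D0_iff_graph)
  show "bij_betw pi_minus F1 Vminus" unfolding Z(2) by (rule bij_pi_minus_graph[OF L[OF Z(1)]])
  show "realization ({0}, F1, UNIV) (pi_minus x) = pi_plus x" if "x \<in> F1" for x
    using that unfolding Z(2) by (simp add: realization_graph[OF L[OF Z(1)]] graph_iff[OF L[OF Z(1)]])
next
  have L: "Z \<in> lin_maps Vminus Vplus" if "Z \<in> Z_domain" for Z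
    using that by (simp add: Z_domain_def skew_maps_def)
  show "bij_betw realization D0 Z_domain"
    by (rule bij_betw_byWitness[where f' = "\<lambda>Z. ({0}, graph Z, UNIV)"])
      (auto simp: D0_iff_graph realization_graph L)
  fix g assume g: "g \<in> G0"
  \<comment> \<open>Since \<open>G0\<close> acts on \<open>D0\<close>, it sends graphs over the
    domain to graphs over the domain.\<close>
  have move: "\<exists>Z'\<in>Z_domain. g ` graph Z = graph Z'" if "Z \<in> Z_domain" for Z
  proof -
    have "flag_act g ({0}, graph Z, UNIV) \<in> D0"
      using that by (intro flag_act_D0[OF g]) (auto simp: D0_iff_graph)
    then show ?thesis by (auto simp: D0_iff_graph flag_act_def)
  qed
  show "bij_betw (denom g Z) Vminus Vminus" "frac_act g Z \<in> Z_domain" if "Z \<in> Z_domain" for Z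
    using move[OF that] frac_act_graph[OF g L[OF that]] L by metis+
  fix F assume F: "F \<in> D0"
  show "flag_act g F \<in> D0" by (rule flag_act_D0[OF g F])
  obtain Z where Z: "Z \<in> Z_domain" "F = ({0}, graph Z, UNIV)" using F by (auto simp: D0_iff_graph)
  obtain Z' where Z': "Z' \<in> Z_domain" "g ` graph Z = graph Z'" using move[OF Z(1)] by blast
  have "flag_act g F = (g ` {0}, graph Z', g ` UNIV)" using Z(2) Z'(2) by (simp add: flag_act_def)
  then show "realization (flag_act g F) = frac_act g (realization F)"
    using frac_act_graph(2)[OF g L[OF Z(1)] L[OF Z'(1)] Z'(2)] Z(2)
    by (simp add: realization_graph L Z(1) Z'(1))
qed

end
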